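(* Let $G_2$ be the simply connected solvable Lie group of dimension $7$ whose Lie algebra is defined, in terms of a basis $e^1,\dots,e^7$ of left invariant $1$-forms, by $$\begin{aligned} de^1&=0,\\ de^2&=\tfrac23e^{12}+\tfrac16e^{15}-\tfrac13e^{34}+\tfrac16e^{46},\\ de^3&=-\tfrac23e^{13}+\tfrac16e^{16}-e^{24}-\tfrac16e^{45},\\ de^4&=-\tfrac23e^{14},\\ de^5&=2(e^{12}+e^{34})-e^{46},\\ de^6&=2(e^{13}+e^{42})+e^{45},\\ de^7&=2(e^{14}+e^{23})-\tfrac16e^{56}, \end{aligned}$$ and let $e_1,\dots,e_7$ be the dual basis of left invariant vector fields. Equip $G_2$ with the left invariant integrable qc structure given by $\eta_1=e^5$, $\eta_2=e^6$, $\eta_3=e^7$, $\xi_1=e_5$, $\xi_2=e_6$, $\xi_3=e_7$, $H=\mathrm{Span}\{e_1,\dots,e_4\}$ (with metric $g$ on $H$ for which $e_1,\dots,e_4$ are orthonormal), $\omega_1=e^{12}+e^{34}$, $\omega_2=e^{13}+e^{42}$, $\omega_3=e^{14}+e^{23}$. Then the torsion endomorphism of the Biquard connection is non-zero, the fundamental $4$-form $\Omega$ is closed, and the normalized qc scalar curvature is $S=-\frac16$.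
   Context: Notation: $e^{ij}=e^i\wedge e^j$. A quaternionic contact (qc) structure on a $7$-dimensional manifold $M$ consists of a rank $4$ distribution $H\subset TM$ with a metric $g$ such that: (i) $H$ is locally the common kernel of three $1$-forms $\eta_1,\eta_2,\eta_3$; (ii) $H$ carries a rank-three bundle $\mathbb{Q}$ of endomorphisms locally generated by almost complex structures $I_1,I_2,I_3$ with $I_1I_2=-I_2I_1=I_3$, $I_1I_2I_3=-\mathrm{id}_{|H}$, $g(I_r\cdot,I_r\cdot)=g(\cdot,\cdot)$; (iii) $2g(I_rX,Y)=d\eta_r(X,Y)$ for $X,Y\in H$. Put $\omega_r(X,Y)=g(I_rX,Y)$ on $H$, so $2\omega_r=d\eta_r{}_{|H}$. The structure is integrable if there are (local) vector fields $\xi_1,\xi_2,\xi_3$ with $\eta_s(\xi_k)=\delta_{sk}$, $(\xi_s\lrcorner d\eta_s)_{|H}=0$, $(\xi_s\lrcorner d\eta_k)_{|H}=-(\xi_k\lrcorner d\eta_s)_{|H}$. Then $V=\mathrm{Span}\{\xi_1,\xi_2,\xi_3\}$, $TM=H\oplus V$, and $g$ is extended to $TM$ by $V\perp H$, $g(\xi_r,\xi_k)=\delta_{rk}$. Biquard connection: the unique linear connection $\nabla$ on $M$, with torsion $T$, such that (i) $\nabla$ preserves $TM=H\oplus V$, $\nabla g=0$ and $\nabla\sigma\in\Gamma(\mathbb{Q})$ for $\sigma\in\Gamma(\mathbb{Q})$; (ii) $T(X,Y)=-[X,Y]_{|V}$ for $X,Y\in H$; (iii) for $\xi\in V$, $T(\xi,\cdot)_{|H}$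 lies in $(sp(1)\oplus sp(1))^{\perp}\subset gl(4)$, where one $sp(1)$ is spanned by $I_1,I_2,I_3$, the other consists of the $g$-skew endomorphisms of $H$ commuting with $I_1,I_2,I_3$, and $\perp$ is with respect to $\langle A,B\rangle=\sum_i g(Ae_i,Be_i)$ for an orthonormal basis of $H$; (iv) $\nabla\varphi=0$ for the natural identification $\varphi:V\to\mathbb{Q}$, $\xi_r\mapsto I_r$. The torsion endomorphism is $T_\xi=T(\xi,\cdot)_{|H}:H\to H$, $\xi\in V$; it is non-zero if $T_\xi\ne0$ for some $\xi\in V$. Fundamental $4$-form: $\Omega=\omega_1\wedge\omega_1+\omega_2\wedge\omega_2+\omega_3\wedge\omega_3$, with $\omega_r$ extended to $TM$ by $\xi\lrcorner\omega_r=0$ for $\xi\in V$. Normalized qc scalar curvature: with $R=[\nabla,\nabla]-\nabla_{[\ ,\ ]}$ the curvature of the Biquard connection and $R(A,B,C,D)=g(R(A,B)C,D)$, $S$ is defined (in dimension $7$) by $24\,S=\sum_{a,b=1}^4R(e_b,e_a,e_a,e_b)$ for a local orthonormal basis $e_1,\dots,e_4$ of $H$. *)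

theory Defs
  imports
    "HOL-Analysis.Analysis"
    "HOL-Algebra.Solvable_Groups"
    "HOL-Combinatorics.Permutations"
    "HOL-Library.Function_Algebras"
begin

section \<open>Smooth manifolds and Lie groups\<close>

text \<open>Only used on open sets, where the following is the usual notion of a \<open>C\<^sup>k\<close> map.\<close>

primrec Ck_on :: "nat \<Rightarrow> 'a::euclidean_space set \<Rightarrow> ('a \<Rightarrow> 'b::real_normed_vector) \<Rightarrow> bool" where
  "Ck_on 0 S f \<longleftrightarrow> continuous_on S f"
| "Ck_on (Suc k) S f \<longleftrightarrow> (\<forall>x\<in>S. f differentiable at x) \<and>
     (\<forall>b\<in>Basis. Ck_on k S (\<lambda>x. frechet_derivative f (at x) b))"

definition smooth_on :: "'a::euclidean_space set \<Rightarrow> ('a \<Rightarrow> 'b::real_normed_vector) \<Rightarrow> bool" where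
  "smooth_on S f \<longleftrightarrow> (\<forall>k. Ck_on k S f)"

text \<open>A chart is a pair of an open domain and a coordinate map. The Hausdorff and second
  countability axioms are left to the type class of the point type.\<close>

type_synonym ('g, 'e) atlas = "('g set \<times> ('g \<Rightarrow> 'e)) set"

definition smooth_atlas :: "('g::topological_space, 'e::euclidean_space) atlas \<Rightarrow> bool" where
  "smooth_atlas A \<longleftrightarrow>
     (\<forall>(U, \<phi>)\<in>A. open U \<and> open (\<phi> ` U) \<and> homeomorphism U (\<phi> ` U) \<phi> (inv_into U \<phi>)) \<and>
     (\<Union>(U, \<phi>)\<in>A. U) = UNIV \<and>
     (\<forall>(U, \<phi>)\<in>A. \<forall>(V, \<psi>)\<in>A. smooth_on (\<phi> ` (U \<inter> V)) (\<psi> \<circ> inv_into U \<phi>))"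

definition smooth_map ::
  "('g::topological_space, 'e::euclidean_space) atlas \<Rightarrow>
   ('h::topological_space, 'f::euclidean_space) atlas \<Rightarrow> ('g \<Rightarrow> 'h) \<Rightarrow> bool" where
  "smooth_map A B f \<longleftrightarrow> continuous_on UNIV f \<and>
     (\<forall>(U, \<phi>)\<in>A. \<forall>(V, \<psi>)\<in>B. smooth_on (\<phi> ` (U \<inter> f -` V)) (\<psi> \<circ> f \<circ> inv_into U \<phi>))"

definition product_atlas :: "('g, 'e) atlas \<Rightarrow> ('h, 'f) atlas \<Rightarrow> ('g \<times> 'h, 'e \<times> 'f) atlas" where
  "product_atlas A B = (\<lambda>((U, \<phi>), (V, \<psi>)). (U \<times> V, map_prod \<phi> \<psi>)) ` (A \<times> B)"

definition smooth_funs ::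
    "('g::topological_space, 'e::euclidean_space) atlas \<Rightarrow> ('g \<Rightarrow> real) set" where
  "smooth_funs A = {f. smooth_map A {(UNIV, id)} f}"

text \<open>The dimension of the Lie group is that of the model space \<open>'e\<close>.\<close>

definition lie_group ::
  "('g::{t2_space, second_countable_topology}, 'e::euclidean_space) atlas \<Rightarrow> 'g monoid \<Rightarrow> bool" where
  "lie_group A G \<longleftrightarrow> smooth_atlas A \<and> group G \<and> carrier G = UNIV \<and>
     smooth_map (product_atlas A A) A (\<lambda>(a, b). a \<otimes>\<^bsub>G\<^esub> b) \<and>
     smooth_map A A (\<lambda>a. inv\<^bsub>G\<^esub> a)"


section \<open>Vector fields and differential forms\<close>

text \<open>Vector fields are derivations of the algebra of smooth functions, and differential forms,
  metrics, endomorphisms and connections are the corresponding operations on the modules of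
  global sections. Sums and products of functions are pointwise. A vector
  field is required to vanish on non-smooth functions, so that equality of vector fields is
  equality in HOL. Forms take the list of their arguments; their values on lists that do not
  consist of vector fields, or have the wrong length, are irrelevant, hence
  the relation \<open>form_eq\<close> below.\<close>

type_synonym 'g vfield = "('g \<Rightarrow> real) \<Rightarrow> 'g \<Rightarrow> real"
type_synonym 'g form = "'g vfield list \<Rightarrow> 'g \<Rightarrow> real"

definition vector_fields ::
    "('g::topological_space, 'e::euclidean_space) atlas \<Rightarrow> 'g vfield set" where
  "vector_fields A = {X.
     (\<forall>f. f \<notin> smooth_funs A \<longrightarrow> X f = 0) \<and>
     (\<forall>f\<in>smooth_funs A. X f \<in> smooth_funs A) \<and>
     (\<forall>f\<in>smooth_funs A. \<forall>h\<in>smooth_funs A. X (f + h) = X f + X h) \<and>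
     (\<forall>c::real. \<forall>f\<in>smooth_funs A. X ((\<lambda>_. c) * f) = (\<lambda>_. c) * X f) \<and>
     (\<forall>f\<in>smooth_funs A. \<forall>h\<in>smooth_funs A. X (f * h) = f * X h + X f * h)}"

definition tangent_space ::
    "('g::topological_space, 'e::euclidean_space) atlas \<Rightarrow> 'g \<Rightarrow> (('g \<Rightarrow> real) \<Rightarrow> real) set" where
  "tangent_space A p = {v.
     (\<forall>f\<in>smooth_funs A. \<forall>h\<in>smooth_funs A. v (f + h) = v f + v h) \<and>
     (\<forall>c::real. \<forall>f\<in>smooth_funs A. v ((\<lambda>_. c) * f) = c * v f) \<and>
     (\<forall>f\<in>smooth_funs A. \<forall>h\<in>smooth_funs A. v (f * h) = f p * v h + v f * h p)}"

definition fscale :: "('g \<Rightarrow> real) \<Rightarrow> 'g vfield \<Rightarrow> 'g vfield"  (infixr "\<odot>" 75) where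
  "u \<odot> X = (\<lambda>f. u * X f)"

definition lie_bracket :: "'g vfield \<Rightarrow> 'g vfield \<Rightarrow> 'g vfield" where
  "lie_bracket X Y = (\<lambda>f. X (Y f) - Y (X f))"

definition diff_form ::
    "('g::topological_space, 'e::euclidean_space) atlas \<Rightarrow> nat \<Rightarrow> 'g form \<Rightarrow> bool" where
  "diff_form A k \<alpha> \<longleftrightarrow> (\<forall>Xs. length Xs = k \<and> set Xs \<subseteq> vector_fields A \<longrightarrow>
     \<alpha> Xs \<in> smooth_funs A \<and>
     (\<forall>i<k. \<forall>Y\<in>vector_fields A. \<alpha> (Xs[i := Xs ! i + Y]) = \<alpha> Xs + \<alpha> (Xs[i := Y])) \<and>
     (\<forall>i<k. \<forall>u\<in>smooth_funs A. \<alpha> (Xs[i := u \<odot> Xs ! i]) = u * \<alpha> Xs) \<and>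
     (\<forall>i<k. \<forall>j<k. i \<noteq> j \<and> Xs ! i = Xs ! j \<longrightarrow> \<alpha> Xs = 0))"

definition form_eq ::
    "('g::topological_space, 'e::euclidean_space) atlas \<Rightarrow> nat \<Rightarrow> 'g form \<Rightarrow> 'g form \<Rightarrow> bool" where
  "form_eq A k \<alpha> \<beta> \<longleftrightarrow> (\<forall>Xs. length Xs = k \<and> set Xs \<subseteq> vector_fields A \<longrightarrow> \<alpha> Xs = \<beta> Xs)"

definition rscale :: "real \<Rightarrow> 'g form \<Rightarrow> 'g form"  (infixr "\<cdot>\<^sub>R" 75) where
  "c \<cdot>\<^sub>R \<alpha> = (\<lambda>Xs p. c * \<alpha> Xs p)"

text \<open>Normalized such that \<open>(\<alpha> \<and> \<beta>)(X, Y) = \<alpha>(X) \<beta>(Y) - \<alpha>(Y) \<beta>(X)\<close> for 1-forms.\<close>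

definition wedge :: "nat \<Rightarrow> nat \<Rightarrow> 'g form \<Rightarrow> 'g form \<Rightarrow> 'g form" where
  "wedge k l \<alpha> \<beta> = (\<lambda>Xs p. 1 / (fact k * fact l) *
     (\<Sum>\<sigma> | \<sigma> permutes {..<k + l}. of_int (sign \<sigma>) *
        \<alpha> (map (\<lambda>i. Xs ! \<sigma> i) [0..<k]) p * \<beta> (map (\<lambda>i. Xs ! \<sigma> i) [k..<k + l]) p))"

definition omit :: "nat \<Rightarrow> 'a list \<Rightarrow> 'a list" where
  "omit i xs = take i xs @ drop (Suc i) xs"

text \<open>The invariant formula for the exterior derivative; on 1-forms it reads
  \<open>d\<alpha>(X, Y) = X(\<alpha>(Y)) - Y(\<alpha>(X)) - \<alpha>([X, Y])\<close>.\<close>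

definition ext_d :: "'g form \<Rightarrow> 'g form" where
  "ext_d \<alpha> = (\<lambda>Xs.
     (\<Sum>i<length Xs. (-1) ^ i * (Xs ! i) (\<alpha> (omit i Xs))) +
     (\<Sum>j<length Xs. \<Sum>i<j.
        (-1) ^ (i + j) * \<alpha> (lie_bracket (Xs ! i) (Xs ! j) # omit i (omit j Xs))))"

definition closed_form ::
    "('g::topological_space, 'e::euclidean_space) atlas \<Rightarrow> nat \<Rightarrow> 'g form \<Rightarrow> bool" where
  "closed_form A k \<alpha> \<longleftrightarrow> diff_form A k \<alpha> \<and> form_eq A (Suc k) (ext_d \<alpha>) 0"

lemma wedge_1_1: "wedge 1 1 \<alpha> \<beta> [X, Y] = \<alpha> [X] * \<beta> [Y] - \<alpha> [Y] * \<beta> [X]"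
proof -
  have eq: "{..<1 + 1::nat} = insert 0 (insert 1 {})" by auto
  have id: "{\<sigma>. \<forall>x::nat. \<sigma> x = x} = {id}" by (simp add: fun_eq_iff set_eq_iff)
  show ?thesis
    unfolding wedge_def eq
    by (simp add: fun_eq_iff sum_over_permutations_insert id sign_swap_id transpose_def)
qed

lemma ext_d_1: "ext_d \<alpha> [X, Y] = X (\<alpha> [Y]) - Y (\<alpha> [X]) - \<alpha> [lie_bracket X Y]"
  by (simp add: ext_d_def omit_def lessThan_Suc)


section \<open>Left invariance\<close>

definition left_push :: "'g monoid \<Rightarrow> 'g \<Rightarrow> 'g vfield \<Rightarrow> 'g vfield" where
  "left_push G a X = (\<lambda>f x. X (\<lambda>y. f (a \<otimes>\<^bsub>G\<^esub> y)) (inv\<^bsub>G\<^esub> a \<otimes>\<^bsub>G\<^esub> x))"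

definition left_inv_vfield ::
  "('g::topological_space, 'e::euclidean_space) atlas \<Rightarrow> 'g monoid \<Rightarrow> 'g vfield \<Rightarrow> bool" where
  "left_inv_vfield A G X \<longleftrightarrow> X \<in> vector_fields A \<and> (\<forall>a. left_push G a X = X)"

definition left_inv_form ::
  "('g::topological_space, 'e::euclidean_space) atlas \<Rightarrow> 'g monoid \<Rightarrow> nat \<Rightarrow> 'g form \<Rightarrow> bool" where
  "left_inv_form A G k \<alpha> \<longleftrightarrow> diff_form A k \<alpha> \<and>
     (\<forall>a. form_eq A k (\<lambda>Xs x. \<alpha> (map (left_push G a) Xs) (a \<otimes>\<^bsub>G\<^esub> x)) \<alpha>)"

text \<open>The left invariant 1-forms \<open>\<theta> 1, \<dots>, \<theta> n\<close> and the left invariant vector fields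
  \<open>e 1, \<dots>, e n\<close> are dual to each other and are bases of the cotangent and of the tangent space
  at each point. Linear independence follows from duality.\<close>

definition left_inv_dual_bases ::
  "('g::topological_space, 'e::euclidean_space) atlas \<Rightarrow> 'g monoid \<Rightarrow> nat \<Rightarrow>
   (nat \<Rightarrow> 'g form) \<Rightarrow> (nat \<Rightarrow> 'g vfield) \<Rightarrow> bool" where
  "left_inv_dual_bases A G n \<theta> e \<longleftrightarrow>
     (\<forall>i\<in>{1..n}. left_inv_form A G 1 (\<theta> i)) \<and>
     (\<forall>i\<in>{1..n}. left_inv_vfield A G (e i)) \<and>
     (\<forall>i\<in>{1..n}. \<forall>j\<in>{1..n}. \<theta> i [e j] = (if i = j then 1 else 0)) \<and>
     (\<forall>p. \<forall>v\<in>tangent_space A p. \<exists>c::nat \<Rightarrow> real. \<forall>f\<in>smooth_funs A. v f = (\<Sum>i=1..n. c i * e i f p))"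


section \<open>Quaternionic contact structures in dimension seven\<close>

text \<open>A qc structure with globally defined contact forms \<open>\<eta>\<^sub>r\<close>, almost complex structures
  \<open>I\<^sub>r\<close> and vector fields \<open>\<xi>\<^sub>r\<close> (\<open>r = 1, 2, 3\<close>): \<open>hor\<close> is the module of sections of \<open>H\<close>,
  and \<open>met\<close> and \<open>acs\<close> are only relevant on \<open>hor\<close>.\<close>

record 'g qc =
  hor :: "'g vfield set"
  met :: "'g vfield \<Rightarrow> 'g vfield \<Rightarrow> 'g \<Rightarrow> real"
  eta :: "nat \<Rightarrow> 'g form"
  acs :: "nat \<Rightarrow> 'g vfield \<Rightarrow> 'g vfield"
  reeb :: "nat \<Rightarrow> 'g vfield"

definition vert ::
    "('g::topological_space, 'e::euclidean_space) atlas \<Rightarrow> 'g qc \<Rightarrow> 'g vfield set" where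
  "vert A Q = {\<Sum>r=1..3. u r \<odot> reeb Q r | u. \<forall>r\<in>{1..3}. u r \<in> smooth_funs A}"

definition vproj :: "'g qc \<Rightarrow> 'g vfield \<Rightarrow> 'g vfield" where
  "vproj Q X = (\<Sum>r=1..3. eta Q r [X] \<odot> reeb Q r)"

definition hproj :: "'g qc \<Rightarrow> 'g vfield \<Rightarrow> 'g vfield" where
  "hproj Q X = X - vproj Q X"

definition ext_met :: "'g qc \<Rightarrow> 'g vfield \<Rightarrow> 'g vfield \<Rightarrow> 'g \<Rightarrow> real" where
  "ext_met Q X Y = met Q (hproj Q X) (hproj Q Y) + (\<Sum>r=1..3. eta Q r [X] * eta Q r [Y])"

definition hor_metric ::
    "('g::topological_space, 'e::euclidean_space) atlas \<Rightarrow> 'g qc \<Rightarrow> bool" where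
  "hor_metric A Q \<longleftrightarrow> (\<forall>X\<in>hor Q. \<forall>Y\<in>hor Q.
     met Q X Y \<in> smooth_funs A \<and> met Q X Y = met Q Y X \<and>
     (\<forall>Z\<in>hor Q. met Q (X + Z) Y = met Q X Y + met Q Z Y) \<and>
     (\<forall>u\<in>smooth_funs A. met Q (u \<odot> X) Y = u * met Q X Y)) \<and>
     (\<forall>X\<in>hor Q. \<forall>p. met Q X X p \<ge> 0 \<and> (met Q X X p = 0 \<longrightarrow> (\<forall>f. X f p = 0)))"

definition hor_endo ::
  "('g::topological_space, 'e::euclidean_space) atlas \<Rightarrow> 'g qc \<Rightarrow> ('g vfield \<Rightarrow> 'g vfield) \<Rightarrow> bool" where
  "hor_endo A Q B \<longleftrightarrow> (\<forall>X\<in>hor Q. B X \<in> hor Q \<and>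
     (\<forall>Y\<in>hor Q. B (X + Y) = B X + B Y) \<and> (\<forall>u\<in>smooth_funs A. B (u \<odot> X) = u \<odot> B X))"

definition hor_orthonormal_frame :: "'g qc \<Rightarrow> (nat \<Rightarrow> 'g vfield) \<Rightarrow> bool" where
  "hor_orthonormal_frame Q E \<longleftrightarrow>
     (\<forall>a\<in>{1..4}. E a \<in> hor Q) \<and>
     (\<forall>a\<in>{1..4}. \<forall>b\<in>{1..4}. met Q (E a) (E b) = (if a = b then 1 else 0)) \<and>
     (\<forall>X\<in>hor Q. X = (\<Sum>a=1..4. met Q X (E a) \<odot> E a))"

text \<open>That \<open>H\<close> has rank four is expressed by the existence of an orthonormal frame
  \<open>E\<^sub>1, \<dots>, E\<^sub>4\<close>, which is required globally like all the other data.\<close>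

definition integrable_qc ::
    "('g::topological_space, 'e::euclidean_space) atlas \<Rightarrow> 'g qc \<Rightarrow> bool" where
  "integrable_qc A Q \<longleftrightarrow>
     (\<forall>r\<in>{1..3}. diff_form A 1 (eta Q r)) \<and>
     hor Q = {X \<in> vector_fields A. \<forall>r\<in>{1..3}. eta Q r [X] = 0} \<and>
     hor_metric A Q \<and>
     (\<exists>E. hor_orthonormal_frame Q E) \<and>
     (\<forall>r\<in>{1..3}. hor_endo A Q (acs Q r)) \<and>
     (\<forall>r\<in>{1..3}. \<forall>X\<in>hor Q. acs Q r (acs Q r X) = - X) \<and>
     (\<forall>X\<in>hor Q. acs Q 1 (acs Q 2 X) = acs Q 3 X \<and> acs Q 2 (acs Q 1 X) = - acs Q 3 X \<and>
        acs Q 1 (acs Q 2 (acs Q 3 X)) = - X) \<and>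
     (\<forall>r\<in>{1..3}. \<forall>X\<in>hor Q. \<forall>Y\<in>hor Q.
        met Q (acs Q r X) (acs Q r Y) = met Q X Y \<and>
        2 * met Q (acs Q r X) Y = ext_d (eta Q r) [X, Y]) \<and>
     (\<forall>r\<in>{1..3}. reeb Q r \<in> vector_fields A) \<and>
     (\<forall>s\<in>{1..3}. \<forall>k\<in>{1..3}. eta Q s [reeb Q k] = (if s = k then 1 else 0)) \<and>
     (\<forall>s\<in>{1..3}. \<forall>X\<in>hor Q. ext_d (eta Q s) [reeb Q s, X] = 0) \<and>
     (\<forall>s\<in>{1..3}. \<forall>k\<in>{1..3}. \<forall>X\<in>hor Q.
        ext_d (eta Q k) [reeb Q s, X] = - ext_d (eta Q s) [reeb Q k, X])"

text \<open>The 2-forms \<open>\<omega>\<^sub>r\<close>, extended to the tangent bundle by zero on \<open>V\<close>.\<close>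

definition omega :: "'g qc \<Rightarrow> nat \<Rightarrow> 'g form" where
  "omega Q r = (\<lambda>Xs. met Q (acs Q r (hproj Q (Xs ! 0))) (hproj Q (Xs ! 1)))"

definition fundamental_4form :: "'g qc \<Rightarrow> 'g form" where
  "fundamental_4form Q = (\<Sum>r=1..3. wedge 2 2 (omega Q r) (omega Q r))"


section \<open>The Biquard connection\<close>

definition linear_connection ::
  "('g::topological_space, 'e::euclidean_space) atlas \<Rightarrow> ('g vfield \<Rightarrow> 'g vfield \<Rightarrow> 'g vfield) \<Rightarrow> bool" where
  "linear_connection A D \<longleftrightarrow> (\<forall>X\<in>vector_fields A. \<forall>Y\<in>vector_fields A.
     D X Y \<in> vector_fields A \<and>
     (\<forall>Z\<in>vector_fields A. D (X + Z) Y = D X Y + D Z Y) \<and>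
     (\<forall>Z\<in>vector_fields A. D X (Y + Z) = D X Y + D X Z) \<and>
     (\<forall>u\<in>smooth_funs A. D (u \<odot> X) Y = u \<odot> D X Y) \<and>
     (\<forall>u\<in>smooth_funs A. D X (u \<odot> Y) = X u \<odot> Y + u \<odot> D X Y))"

definition torsion :: "('g vfield \<Rightarrow> 'g vfield \<Rightarrow> 'g vfield) \<Rightarrow> 'g vfield \<Rightarrow> 'g vfield \<Rightarrow> 'g vfield" where
  "torsion D X Y = D X Y - D Y X - lie_bracket X Y"

definition curvature ::
  "('g vfield \<Rightarrow> 'g vfield \<Rightarrow> 'g vfield) \<Rightarrow> 'g vfield \<Rightarrow> 'g vfield \<Rightarrow> 'g vfield \<Rightarrow> 'g vfield" where
  "curvature D X Y Z = D X (D Y Z) - D Y (D X Z) - D (lie_bracket X Y) Z"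

definition endo_deriv ::
  "('g vfield \<Rightarrow> 'g vfield \<Rightarrow> 'g vfield) \<Rightarrow> 'g vfield \<Rightarrow> ('g vfield \<Rightarrow> 'g vfield) \<Rightarrow> 'g vfield \<Rightarrow> 'g vfield" where
  "endo_deriv D Z B = (\<lambda>X. D Z (B X) - B (D Z X))"

text \<open>\<open>B\<close> restricts on \<open>H\<close> to a section of the bundle generated by \<open>I\<^sub>1, I\<^sub>2, I\<^sub>3\<close>.\<close>

definition quaternionic_section ::
  "('g::topological_space, 'e::euclidean_space) atlas \<Rightarrow> 'g qc \<Rightarrow> ('g vfield \<Rightarrow> 'g vfield) \<Rightarrow> bool" where
  "quaternionic_section A Q B \<longleftrightarrow> (\<exists>u. (\<forall>r\<in>{1..3}. u r \<in> smooth_funs A) \<and>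
     (\<forall>X\<in>hor Q. B X = (\<Sum>r=1..3. u r \<odot> acs Q r X)))"

definition commuting_skew_endo ::
  "('g::topological_space, 'e::euclidean_space) atlas \<Rightarrow> 'g qc \<Rightarrow> ('g vfield \<Rightarrow> 'g vfield) \<Rightarrow> bool" where
  "commuting_skew_endo A Q B \<longleftrightarrow> hor_endo A Q B \<and>
     (\<forall>X\<in>hor Q. \<forall>Y\<in>hor Q. met Q (B X) Y = - met Q X (B Y)) \<and>
     (\<forall>r\<in>{1..3}. \<forall>X\<in>hor Q. B (acs Q r X) = acs Q r (B X))"

definition endo_inner ::
  "'g qc \<Rightarrow> (nat \<Rightarrow> 'g vfield) \<Rightarrow> ('g vfield \<Rightarrow> 'g vfield) \<Rightarrow> ('g vfield \<Rightarrow> 'g vfield) \<Rightarrow> 'g \<Rightarrow> real" where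
  "endo_inner Q E B C = (\<Sum>a=1..4. met Q (B (E a)) (C (E a)))"

definition phi :: "'g qc \<Rightarrow> 'g vfield \<Rightarrow> 'g vfield \<Rightarrow> 'g vfield" where
  "phi Q \<xi> = (\<lambda>X. \<Sum>r=1..3. eta Q r [\<xi>] \<odot> acs Q r X)"

definition biquard_connection ::
  "('g::topological_space, 'e::euclidean_space) atlas \<Rightarrow> 'g qc \<Rightarrow>
   ('g vfield \<Rightarrow> 'g vfield \<Rightarrow> 'g vfield) \<Rightarrow> bool" where
  "biquard_connection A Q D \<longleftrightarrow> linear_connection A D \<and>
     (\<forall>Z\<in>vector_fields A. \<forall>X\<in>hor Q. D Z X \<in> hor Q) \<and>
     (\<forall>Z\<in>vector_fields A. \<forall>\<xi>\<in>vert A Q. D Z \<xi> \<in> vert A Q) \<and>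
     (\<forall>Z\<in>vector_fields A. \<forall>X\<in>vector_fields A. \<forall>Y\<in>vector_fields A.
        Z (ext_met Q X Y) = ext_met Q (D Z X) Y + ext_met Q X (D Z Y)) \<and>
     (\<forall>Z\<in>vector_fields A. \<forall>B. quaternionic_section A Q B \<longrightarrow>
        quaternionic_section A Q (endo_deriv D Z B)) \<and>
     (\<forall>X\<in>hor Q. \<forall>Y\<in>hor Q. torsion D X Y = - vproj Q (lie_bracket X Y)) \<and>
     (\<forall>\<xi>\<in>vert A Q. (\<forall>X\<in>hor Q. torsion D \<xi> X \<in> hor Q) \<and>
        (\<forall>B E. (quaternionic_section A Q B \<or> commuting_skew_endo A Q B) \<and>
           hor_orthonormal_frame Q E \<longrightarrow> endo_inner Q E (torsion D \<xi>) B = 0)) \<and>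
     (\<forall>Z\<in>vector_fields A. \<forall>\<xi>\<in>vert A Q. \<forall>X\<in>hor Q.
        endo_deriv D Z (phi Q \<xi>) X = phi Q (D Z \<xi>) X)"

definition nonzero_torsion_endo ::
  "('g::topological_space, 'e::euclidean_space) atlas \<Rightarrow> 'g qc \<Rightarrow>
   ('g vfield \<Rightarrow> 'g vfield \<Rightarrow> 'g vfield) \<Rightarrow> bool" where
  "nonzero_torsion_endo A Q D \<longleftrightarrow> (\<exists>\<xi>\<in>vert A Q. \<exists>X\<in>hor Q. torsion D \<xi> X \<noteq> 0)"

definition norm_qc_scal ::
  "'g qc \<Rightarrow> ('g vfield \<Rightarrow> 'g vfield \<Rightarrow> 'g vfield) \<Rightarrow> (nat \<Rightarrow> 'g vfield) \<Rightarrow> 'g \<Rightarrow> real" where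
  "norm_qc_scal Q D E = (\<lambda>p. 1 / 24 *
     (\<Sum>a=1..4. \<Sum>b=1..4. ext_met Q (curvature D (E b) (E a) (E a)) (E b) p))"


section \<open>The qc structure of a left invariant coframe in dimension seven\<close>

definition cowedge :: "(nat \<Rightarrow> 'g form) \<Rightarrow> nat \<Rightarrow> nat \<Rightarrow> 'g form" where
  "cowedge \<theta> i j = wedge 1 1 (\<theta> i) (\<theta> j)"

definition coframe_omega :: "(nat \<Rightarrow> 'g form) \<Rightarrow> nat \<Rightarrow> 'g form" where
  "coframe_omega \<theta> r =
     (if r = 1 then cowedge \<theta> 1 2 + cowedge \<theta> 3 4
      else if r = 2 then cowedge \<theta> 1 3 + cowedge \<theta> 4 2
      else cowedge \<theta> 1 4 + cowedge \<theta> 2 3)"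

text \<open>\<open>I\<^sub>r X = \<Sum>\<^sub>a \<omega>\<^sub>r(X, e\<^sub>a) e\<^sub>a\<close> is the endomorphism with \<open>\<omega>\<^sub>r(X, Y) = g(I\<^sub>r X, Y)\<close>.\<close>

definition coframe_qc ::
  "('g::topological_space, 'e::euclidean_space) atlas \<Rightarrow> (nat \<Rightarrow> 'g form) \<Rightarrow>
   (nat \<Rightarrow> 'g vfield) \<Rightarrow> 'g qc" where
  "coframe_qc A \<theta> e =
     \<lparr> hor = {\<Sum>a=1..4. u a \<odot> e a | u. \<forall>a\<in>{1..4}. u a \<in> smooth_funs A},
       met = (\<lambda>X Y. \<Sum>a=1..4. \<theta> a [X] * \<theta> a [Y]),
       eta = (\<lambda>r. \<theta> (4 + r)),
       acs = (\<lambda>r X. \<Sum>a=1..4. coframe_omega \<theta> r [X, e a] \<odot> e a),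
       reeb = (\<lambda>r. e (4 + r)) \<rparr>"

end

theory Submission
  imports Defs
begin

text \<open>
  Left invariance makes \<open>e\<^sub>1, \<dots>, e\<^sub>7\<close> a global frame: every vector field is a combination of the \<open>e\<^sub>i\<close> whose
  coefficients are the smooth functions \<open>\<theta>\<^sub>i(X)\<close>. Smoothness of the coefficients is the only analytic
  point. It is obtained from Cramer's rule, applied to the derivatives of seven smooth functions that are
  dual to the frame at a point (\<open>frame_coefficients_smooth\<close>, \<open>left_inv_dual_bases_coframe\<close>).
  Everything after that is algebra with derivations: a vector field is determined by its components, and
  the structure equations give the components of a bracket.

  The qc conditions are read off from the structure equations (\<open>integrable_qc\<close>). The Biquard connection is
  given by an explicit skew matrix of 1-forms (\<open>bconn_biquard\<close>): the Koszul formula determines it for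
  horizontal directions, in a vertical direction \<open>\<xi>\<close> it is the skew part of \<open>ad \<xi>\<close> on \<open>H\<close>, and \<open>\<nabla>\<phi> = 0\<close>
  determines it on \<open>V\<close>. Conversely, two Biquard connections agree on horizontal fields
  (\<open>biquard_unique_on_hor\<close>), because their difference is skew, symmetric in horizontal arguments, and in
  vertical directions orthogonal to \<open>sp(1) \<oplus> sp(1) = so(4)\<close>. Hence torsion endomorphism and horizontal
  curvature of any Biquard connection are those of the explicit one. In the frame,
  \<open>T(e\<^sub>5, e\<^sub>1) = - (1/12) e\<^sub>2\<close>, which is non-zero, and \<open>R(X, Y, Y, X)\<close> is a quadratic form in the
  Pluecker coordinates of the horizontal fields \<open>X\<close>, \<open>Y\<close>; its sum over any orthonormal frame of \<open>H\<close> is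
  \<open>- 4 = 24 S\<close> (\<open>biquard_norm_qc_scal\<close>).

  Finally \<open>\<Omega>\<close> is six times \<open>\<theta>\<^sub>1 \<and> \<theta>\<^sub>2 \<and> \<theta>\<^sub>3 \<and> \<theta>\<^sub>4\<close>, and by the Leibniz rule each term of its derivative
  has a repeated factor (\<open>fundamental_4form_closed\<close>).
\<close>

section \<open>Smooth functions\<close>

text \<open>The class \<open>C\<^sup>k\<close> is defined through the Frechet derivative of the whole function, so
  passing to another function with the same restriction needs an open domain.\<close>

lemma Ck_on_cong:
  assumes "open S" "\<And>x. x \<in> S \<Longrightarrow> f x = g x" "Ck_on k S f"
  shows "Ck_on k S g"
  using assms
proof (induction k arbitrary: f g)
  case 0
  then show ?case using continuous_on_cong by force
next
  case (Suc k)
  have *: "frechet_derivative f (at x) = frechet_derivative g (at x)" "g differentiable (at x)"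
    if "x \<in> S" for x
  proof -
    have "f differentiable at x" using Suc.prems that by simp
    then show "g differentiable (at x)"
      using Suc.prems(1,2) that has_derivative_transform_within_open[of f _ x UNIV S g]
      unfolding differentiable_def by auto
    show "frechet_derivative f (at x) = frechet_derivative g (at x)"
      using Suc.prems that \<open>f differentiable at x\<close>
      by (intro frechet_derivative_transform_within_open[of _ _ S]) auto
  qed
  have "Ck_on k S (\<lambda>x. frechet_derivative g (at x) b)" if "b \<in> Basis" for b
  proof (rule Suc.IH[OF assms(1)])
    show "Ck_on k S (\<lambda>x. frechet_derivative f (at x) b)" using Suc.prems(3) that by simp
    show "frechet_derivative f (at x) b = frechet_derivative g (at x) b" if "x \<in> S" for x
      by (simp only: *(1)[OF that])
  qed
  then show ?case using *(2) unfolding Ck_on.simps(2) by blast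
qed

lemma Ck_on_subset: "Ck_on k S f \<Longrightarrow> T \<subseteq> S \<Longrightarrow> Ck_on k T f"
  by (induction k arbitrary: f) (auto intro: continuous_on_subset)

text \<open>Differentiability at a point only depends on the germ, so the class \<open>C\<^sup>k\<close> is local.
  This is what allows a function to be a different quotient near each point.\<close>

lemma Ck_on_locally:
  assumes "\<And>x. x \<in> S \<Longrightarrow> \<exists>T. open T \<and> x \<in> T \<and> Ck_on k T f"
  shows "Ck_on k S f"
  using assms
proof (induction k arbitrary: f)
  case 0
  have "isCont f x" if "x \<in> S" for x
    using 0[OF that] by (auto simp: continuous_on_eq_continuous_at)
  then show ?case by (auto intro: continuous_at_imp_continuous_on)
next
  case (Suc k)
  have "f differentiable at x" if "x \<in> S" for x
    using Suc.prems[OF that] by auto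
  moreover have "Ck_on k S (\<lambda>x. frechet_derivative f (at x) b)" if "b \<in> Basis" for b
    by (rule Suc.IH) (use Suc.prems that in fastforce)
  ultimately show ?case by simp
qed

lemma Ck_on_SucD: "Ck_on (Suc k) S f \<Longrightarrow> Ck_on k S f"
proof (induction k arbitrary: f)
  case 0
  then show ?case
    by (auto intro!: continuous_at_imp_continuous_on differentiable_imp_continuous_within)
next
  case (Suc k)
  show ?case
    unfolding Ck_on.simps(2)[of k]
    using Suc.prems[unfolded Ck_on.simps(2)[of "Suc k"]] Suc.IH by blast
qed

lemma Ck_on_const: "Ck_on k S (\<lambda>_. c)"
  by (induction k arbitrary: c) auto

lemma Ck_on_add:
  assumes "open S" "Ck_on k S f" "Ck_on k S g"
  shows "Ck_on k S (\<lambda>x. f x + g x)"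
  using assms(2,3)
proof (induction k arbitrary: f g)
  case 0
  then show ?case by (auto intro: continuous_on_add)
next
  case (Suc k)
  have d: "((\<lambda>x. f x + g x) has_derivative
      (\<lambda>b. frechet_derivative f (at x) b + frechet_derivative g (at x) b)) (at x)" if "x \<in> S" for x
    using Suc.prems that by (intro has_derivative_add) (auto simp: frechet_derivative_works)
  have "Ck_on k S (\<lambda>x. frechet_derivative (\<lambda>x. f x + g x) (at x) b)" if "b \<in> Basis" for b
    by (rule Ck_on_cong[OF assms(1) _ Suc.IH])
       (use Suc.prems that in \<open>auto simp: frechet_derivative_at[OF d, symmetric]\<close>)
  then show ?case using d by (auto simp: differentiable_def)
qed

lemma Ck_on_mult:
  fixes f g :: "'a::euclidean_space \<Rightarrow> real"
  assumes "open S" "Ck_on k S f" "Ck_on k S g"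
  shows "Ck_on k S (\<lambda>x. f x * g x)"
  using assms(2,3)
proof (induction k arbitrary: f g)
  case 0
  then show ?case by (auto intro: continuous_on_mult)
next
  case (Suc k)
  have lower: "Ck_on k S f" "Ck_on k S g" by (rule Ck_on_SucD, fact)+
  have d: "((\<lambda>x. f x * g x) has_derivative
      (\<lambda>b. f x * frechet_derivative g (at x) b + frechet_derivative f (at x) b * g x)) (at x)"
    if "x \<in> S" for x
    using Suc.prems that by (intro has_derivative_mult) (auto simp: frechet_derivative_works)
  have "Ck_on k S (\<lambda>x. frechet_derivative (\<lambda>x. f x * g x) (at x) b)" if b: "b \<in> Basis" for b
    by (rule Ck_on_cong[OF assms(1) _ Ck_on_add[OF assms(1) Suc.IH Suc.IH,
            of f "\<lambda>x. frechet_derivative g (at x) b" "\<lambda>x. frechet_derivative f (at x) b" g]])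
       (use Suc.prems lower b in \<open>auto simp: frechet_derivative_at[OF d, symmetric]\<close>)
  then show ?case using d by (auto simp: differentiable_def)
qed

lemma Ck_on_inverse:
  fixes f :: "'a::euclidean_space \<Rightarrow> real"
  assumes "open S" "\<And>x. x \<in> S \<Longrightarrow> f x \<noteq> 0" "Ck_on k S f"
  shows "Ck_on k S (\<lambda>x. inverse (f x))"
  using assms(3)
proof (induction k)
  case 0
  then show ?case using assms(2) by (auto intro: continuous_on_inverse)
next
  case (Suc k)
  have d: "((\<lambda>x. inverse (f x)) has_derivative
      (\<lambda>b. - (inverse (f x) * frechet_derivative f (at x) b * inverse (f x)))) (at x)"
    if "x \<in> S" for x
    using Suc.prems that assms(2)
    by (intro Deriv.has_derivative_inverse) (auto simp: frechet_derivative_works)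
  have "Ck_on k S (\<lambda>x. inverse (f x))" by (rule Suc.IH[OF Ck_on_SucD[OF Suc.prems]])
  moreover have "Ck_on k S (\<lambda>x. frechet_derivative f (at x) b)" if "b \<in> Basis" for b
    using Suc.prems that by simp
  ultimately have *: "Ck_on k S (\<lambda>x. (-1) * (inverse (f x) * frechet_derivative f (at x) b * inverse (f x)))"
    if "b \<in> Basis" for b
    using that by (intro Ck_on_mult[OF assms(1)] Ck_on_const)
  have "Ck_on k S (\<lambda>x. frechet_derivative (\<lambda>x. inverse (f x)) (at x) b)" if "b \<in> Basis" for b
    by (rule Ck_on_cong[OF assms(1) _ *])
       (use that in \<open>auto simp: frechet_derivative_at[OF d, symmetric]\<close>)
  then show ?case using d by (auto simp: differentiable_def)
qed

lemma smooth_funs_iff: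
  "f \<in> smooth_funs A \<longleftrightarrow> continuous_on UNIV f \<and>
     (\<forall>(U, \<phi>)\<in>A. \<forall>k. Ck_on k (\<phi> ` U) (\<lambda>y. f (inv_into U \<phi> y)))"
  by (auto simp: smooth_funs_def smooth_map_def smooth_on_def o_def)

lemma smooth_funs_chart:
  assumes "f \<in> smooth_funs A" "(U, \<phi>) \<in> A" "T \<subseteq> \<phi> ` U"
  shows "Ck_on k T (\<lambda>y. f (inv_into U \<phi> y))"
  using assms(1,2) by (intro Ck_on_subset[OF _ assms(3)]) (fastforce simp: smooth_funs_iff)

lemma smooth_const: "(\<lambda>_. c) \<in> smooth_funs A"
  by (auto simp: smooth_funs_iff Ck_on_const)

context
  fixes A :: "('g::t2_space, 'e::euclidean_space) atlas"
  assumes A: "smooth_atlas A"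
begin

lemma chart_open: "(U, \<phi>) \<in> A \<Longrightarrow> open (\<phi> ` U)"
  using A by (auto simp: smooth_atlas_def)

lemma smooth_add: "f \<in> smooth_funs A \<Longrightarrow> g \<in> smooth_funs A \<Longrightarrow> f + g \<in> smooth_funs A"
  by (auto simp: smooth_funs_iff plus_fun_def intro!: continuous_on_add Ck_on_add chart_open)

lemma smooth_mult: "f \<in> smooth_funs A \<Longrightarrow> g \<in> smooth_funs A \<Longrightarrow> f * g \<in> smooth_funs A"
  by (auto simp: smooth_funs_iff times_fun_def intro!: continuous_on_mult Ck_on_mult chart_open)

text \<open>A function that solves a linear equation with smooth coefficients is smooth, because
  locally it is a quotient of smooth functions.\<close>

lemma smooth_quotient:
  assumes "\<And>p. \<exists>u\<in>smooth_funs A. \<exists>h\<in>smooth_funs A. h p \<noteq> 0 \<and> (\<forall>x. c x * h x = u x)"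
  shows "c \<in> smooth_funs A"
  unfolding smooth_funs_iff
proof (intro conjI ballI allI, safe)
  have "isCont c p" for p
  proof -
    obtain u h where u: "u \<in> smooth_funs A" and h: "h \<in> smooth_funs A"
      and nz: "h p \<noteq> 0" and eq: "\<And>x. c x * h x = u x"
      using assms by meson
    have cont: "isCont u p" "isCont h p" and conth: "continuous_on UNIV h"
      using u h by (auto simp: smooth_funs_iff continuous_on_eq_continuous_at)
    have "open {x. h x \<noteq> 0}"
      using conth by (simp add: open_Collect_neq)
    moreover have "isCont (\<lambda>x. u x / h x) p"
      using cont nz by (intro continuous_intros) auto
    moreover have "c x = u x / h x" if "x \<in> {x. h x \<noteq> 0}" for x
      using eq[of x] that by (auto simp: field_simps)
    ultimately show "isCont c p"
      using nz isCont_cong[of c "\<lambda>x. u x / h x" p] eventually_nhds[of _ p] by blast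
  qed
  then show "continuous_on UNIV c" by (auto intro: continuous_at_imp_continuous_on)
next
  fix U \<phi> k assume chart: "(U, \<phi>) \<in> A"
  let ?i = "inv_into U \<phi>"
  have hom: "homeomorphism U (\<phi> ` U) \<phi> ?i" and op: "open (\<phi> ` U)"
    using A chart by (auto simp: smooth_atlas_def)
  show "Ck_on k (\<phi> ` U) (\<lambda>y. c (?i y))"
  proof (rule Ck_on_locally)
    fix y assume y: "y \<in> \<phi> ` U"
    obtain u h where u: "u \<in> smooth_funs A" and h: "h \<in> smooth_funs A"
      and nz: "h (?i y) \<noteq> 0" and eq: "\<And>x. c x * h x = u x"
      using assms by meson
    define T where "T = {z \<in> \<phi> ` U. h (?i z) \<noteq> 0}"
    have "continuous_on (\<phi> ` U) (\<lambda>z. h (?i z))"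
      using smooth_funs_chart[OF h chart, of "\<phi> ` U" 0] by simp
    then have "open T"
      unfolding T_def using op continuous_open_preimage[of "\<phi> ` U" "\<lambda>z. h (?i z)" "- {0}"]
      by (simp add: vimage_def Int_def open_Compl)
    moreover have "Ck_on k T (\<lambda>z. u (?i z) * inverse (h (?i z)))"
      using \<open>open T\<close>
      by (intro Ck_on_mult Ck_on_inverse smooth_funs_chart[OF u chart] smooth_funs_chart[OF h chart])
         (auto simp: T_def)
    then have "Ck_on k T (\<lambda>z. c (?i z))"
      by (rule Ck_on_cong[OF \<open>open T\<close>, rotated]) (auto simp: T_def field_simps simp flip: eq)
    ultimately show "\<exists>T. open T \<and> y \<in> T \<and> Ck_on k T (\<lambda>z. c (?i z))"
      using y nz by (auto simp: T_def)
  qed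
qed

end

section \<open>Vector fields as derivations\<close>

context
  fixes A :: "('g::t2_space, 'e::euclidean_space) atlas"
  assumes A: "smooth_atlas A"
begin

lemma smooth_uminus: "f \<in> smooth_funs A \<Longrightarrow> - f \<in> smooth_funs A"
  using smooth_mult[OF A smooth_const[of "-1" A], of f]
  by (simp add: times_fun_def fun_Compl_def)

lemma smooth_diff: "f \<in> smooth_funs A \<Longrightarrow> g \<in> smooth_funs A \<Longrightarrow> f - g \<in> smooth_funs A"
  using smooth_add[OF A _ smooth_uminus, of f g] by simp

lemma smooth_zero: "0 \<in> smooth_funs A"
  using smooth_const[of 0 A] by (simp add: zero_fun_def)

lemma smooth_one: "1 \<in> smooth_funs A"
  using smooth_const[of 1 A] by (simp add: one_fun_def)

lemma smooth_sum: "(\<And>i. i \<in> I \<Longrightarrow> f i \<in> smooth_funs A) \<Longrightarrow> sum f I \<in> smooth_funs A"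
  by (induction I rule: infinite_finite_induct) (auto intro: smooth_zero smooth_add[OF A])

lemma smooth_prod: "(\<And>i. i \<in> I \<Longrightarrow> f i \<in> smooth_funs A) \<Longrightarrow> prod f I \<in> smooth_funs A"
  by (induction I rule: infinite_finite_induct) (auto intro: smooth_one smooth_mult[OF A])

lemma vf_nonsmooth: "X \<in> vector_fields A \<Longrightarrow> f \<notin> smooth_funs A \<Longrightarrow> X f = 0"
  by (auto simp: vector_fields_def)

lemma vf_smooth: "X \<in> vector_fields A \<Longrightarrow> X f \<in> smooth_funs A"
  by (cases "f \<in> smooth_funs A") (auto simp: vector_fields_def smooth_zero)

lemma vf_add_fun:
  "X \<in> vector_fields A \<Longrightarrow> f \<in> smooth_funs A \<Longrightarrow> h \<in> smooth_funs A \<Longrightarrow> X (f + h) = X f + X h"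
  by (simp add: vector_fields_def)

lemma vf_mult_fun:
  "X \<in> vector_fields A \<Longrightarrow> f \<in> smooth_funs A \<Longrightarrow> h \<in> smooth_funs A \<Longrightarrow> X (f * h) = f * X h + X f * h"
  by (simp add: vector_fields_def)

lemma vf_const: assumes "X \<in> vector_fields A" shows "X (\<lambda>_. c) = 0"
proof -
  have "X (1 * 1) = 1 * X 1 + X 1 * 1"
    using assms smooth_one by (rule vf_mult_fun) (rule smooth_one)
  then have "X 1 = 0" by simp
  moreover have "X ((\<lambda>_. c) * 1) = (\<lambda>_. c) * X 1"
    using assms smooth_one unfolding vector_fields_def by blast
  ultimately show ?thesis by (simp only: mult_1_right mult_zero_right)
qed

lemma vf_zero_fun: "X \<in> vector_fields A \<Longrightarrow> X 0 = 0"
  using vf_const[of X 0] by (simp add: zero_fun_def)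

lemma vf_one_fun: "X \<in> vector_fields A \<Longrightarrow> X 1 = 0"
  using vf_const[of X 1] by (simp add: one_fun_def)

lemma vf_uminus_fun:
  assumes "X \<in> vector_fields A" "f \<in> smooth_funs A" shows "X (- f) = - X f"
proof -
  have "X (f + - f) = X f + X (- f)" using assms smooth_uminus by (intro vf_add_fun)
  then show ?thesis using vf_zero_fun[OF assms(1)] by (simp add: add_eq_0_iff)
qed

lemma vf_diff_fun:
  "X \<in> vector_fields A \<Longrightarrow> f \<in> smooth_funs A \<Longrightarrow> h \<in> smooth_funs A \<Longrightarrow> X (f - h) = X f - X h"
  using vf_add_fun[of X f "- h"] vf_uminus_fun[of X h] by (simp add: smooth_uminus fun_eq_iff)

lemma vf_add: "X \<in> vector_fields A \<Longrightarrow> Y \<in> vector_fields A \<Longrightarrow> X + Y \<in> vector_fields A"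
  by (auto simp: vector_fields_def plus_fun_def[of X Y] smooth_add[OF A] algebra_simps)

lemma vf_scale: "u \<in> smooth_funs A \<Longrightarrow> X \<in> vector_fields A \<Longrightarrow> u \<odot> X \<in> vector_fields A"
  by (auto simp: vector_fields_def fscale_def smooth_mult[OF A] algebra_simps)

lemma vf_zero: "0 \<in> vector_fields A"
  by (auto simp: vector_fields_def smooth_zero)

lemma vf_uminus: "X \<in> vector_fields A \<Longrightarrow> - X \<in> vector_fields A"
  by (auto simp: vector_fields_def fun_Compl_def[of X] smooth_uminus algebra_simps)

lemma vf_diff: "X \<in> vector_fields A \<Longrightarrow> Y \<in> vector_fields A \<Longrightarrow> X - Y \<in> vector_fields A"
  using vf_add[of X "- Y"] by (simp add: vf_uminus)

lemma vf_sum: "(\<And>i. i \<in> I \<Longrightarrow> X i \<in> vector_fields A) \<Longrightarrow> sum X I \<in> vector_fields A"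
  by (induction I rule: infinite_finite_induct) (auto intro: vf_zero vf_add)

lemma vf_bracket:
  assumes X: "X \<in> vector_fields A" and Y: "Y \<in> vector_fields A"
  shows "lie_bracket X Y \<in> vector_fields A"
proof -
  note s = vf_smooth[OF X] vf_smooth[OF Y]
  show ?thesis
    unfolding vector_fields_def lie_bracket_def mem_Collect_eq
  proof (intro conjI allI impI ballI)
    fix f assume "f \<notin> smooth_funs A"
    then show "X (Y f) - Y (X f) = 0"
      by (simp add: vf_nonsmooth[OF X] vf_nonsmooth[OF Y] vf_zero_fun[OF X] vf_zero_fun[OF Y])
  next
    fix f show "X (Y f) - Y (X f) \<in> smooth_funs A"
      by (intro smooth_diff s)
  next
    fix f h assume f: "f \<in> smooth_funs A" and h: "h \<in> smooth_funs A"
    show "X (Y (f + h)) - Y (X (f + h)) = X (Y f) - Y (X f) + (X (Y h) - Y (X h))"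
      by (simp only: vf_add_fun[OF X f h] vf_add_fun[OF Y f h] vf_add_fun[OF X s(2,2)]
          vf_add_fun[OF Y s(1,1)]) simp
    note sm = smooth_mult[OF A]
    show "X (Y (f * h)) - Y (X (f * h)) = f * (X (Y h) - Y (X h)) + (X (Y f) - Y (X f)) * h"
      by (simp only: vf_mult_fun[OF X f h] vf_mult_fun[OF Y f h]
          vf_add_fun[OF X sm[OF f s(2)] sm[OF s(2) h]] vf_add_fun[OF Y sm[OF f s(1)] sm[OF s(1) h]]
          vf_mult_fun[OF X f s(2)] vf_mult_fun[OF X s(2) h] vf_mult_fun[OF Y f s(1)] vf_mult_fun[OF Y s(1) h])
         (simp add: algebra_simps)
  next
    fix c :: real and f assume f: "f \<in> smooth_funs A"
    note c = smooth_const[of c A]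
    show "X (Y ((\<lambda>_. c) * f)) - Y (X ((\<lambda>_. c) * f)) = (\<lambda>_. c) * (X (Y f) - Y (X f))"
      by (simp only: vf_mult_fun[OF X c f] vf_mult_fun[OF Y c f] vf_const[OF X] vf_const[OF Y]
          mult_zero_left add_0_right vf_mult_fun[OF X c s(2)] vf_mult_fun[OF Y c s(1)] right_diff_distrib)
  qed
qed

end

section \<open>Smooth coefficients with respect to a frame\<close>

text \<open>By duality of finite-dimensional spaces, pointwise linear independence yields smooth functions
  \<open>f\<^sub>j\<close> with \<open>E\<^sub>i f\<^sub>j = \<delta>\<^sub>i\<^sub>j\<close> at a given point. Cramer's rule for the linear system
  \<open>X f\<^sub>j = \<Sum>\<^sub>i c\<^sub>i E\<^sub>i f\<^sub>j\<close> then writes \<open>c\<^sub>i\<close> near that point as a quotient of smooth functions, so that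
  neither bump functions nor local coordinates are needed.\<close>

lemma frame_coefficients_smooth:
  fixes A :: "('g::t2_space, 'e::euclidean_space) atlas" and E :: "'n::finite \<Rightarrow> 'g vfield"
  assumes A: "smooth_atlas A"
    and E: "\<And>i. E i \<in> vector_fields A" and X: "X \<in> vector_fields A"
    and indep: "\<And>p a. (\<And>f. f \<in> smooth_funs A \<Longrightarrow> (\<Sum>i\<in>UNIV. a i * E i f p) = 0) \<Longrightarrow> a = (\<lambda>_. 0)"
    and c: "\<And>p f. f \<in> smooth_funs A \<Longrightarrow> X f p = (\<Sum>i\<in>UNIV. c i p * E i f p)"
  shows "c k \<in> smooth_funs A"
proof (rule smooth_quotient[OF A])
  fix p
  define S where "S = (\<lambda>f. \<chi> i. E i f p) ` smooth_funs A"
  have "subspace S"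
  proof (unfold subspace_def, intro conjI ballI allI)
    have "(\<chi> i. E i 0 p) = 0" by (simp add: vec_eq_iff vf_zero_fun[OF A E])
    then show "0 \<in> S" using smooth_zero[OF A] unfolding S_def by (metis imageI)
  next
    fix v w assume "v \<in> S" "w \<in> S"
    then obtain f h where f: "f \<in> smooth_funs A" "v = (\<chi> i. E i f p)"
      and h: "h \<in> smooth_funs A" "w = (\<chi> i. E i h p)" by (auto simp: S_def)
    have "v + w = (\<chi> i. E i (f + h) p)"
      using f h by (simp add: vec_eq_iff vf_add_fun[OF A E])
    then show "v + w \<in> S" unfolding S_def using f h smooth_add[OF A] by auto
  next
    fix r :: real and v assume "v \<in> S"
    then obtain f where f: "f \<in> smooth_funs A" "v = (\<chi> i. E i f p)" by (auto simp: S_def)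
    have "r *\<^sub>R v = (\<chi> i. E i ((\<lambda>_. r) * f) p)"
      using f by (simp add: vec_eq_iff vf_mult_fun[OF A E] smooth_const vf_const[OF A E])
    then show "r *\<^sub>R v \<in> S"
      unfolding S_def using f smooth_mult[OF A smooth_const[of r A]] by auto
  qed
  have "S = UNIV"
  proof (rule ccontr)
    assume "S \<noteq> UNIV"
    then have "span S \<noteq> UNIV" using \<open>subspace S\<close> by (metis span_eq_iff)
    then obtain a where a: "a \<noteq> 0" "\<forall>x\<in>span S. a \<bullet> x = 0"
      using span_not_UNIV_orthogonal by blast
    have "(\<lambda>i. a $ i) = (\<lambda>_. 0)"
    proof (rule indep[of _ p])
      fix f assume "f \<in> smooth_funs A"
      then have "(\<chi> i. E i f p) \<in> span S" by (auto simp: S_def intro: span_base)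
      then show "(\<Sum>i\<in>UNIV. a $ i * E i f p) = 0" using a(2) by (auto simp: inner_vec_def)
    qed
    then show False using a(1) by (auto simp: vec_eq_iff fun_eq_iff)
  qed
  then have "\<forall>j. axis j 1 \<in> (\<lambda>f. \<chi> i. E i f p) ` smooth_funs A"
    by (simp add: S_def)
  then have "\<forall>j. \<exists>f. f \<in> smooth_funs A \<and> (\<chi> i. E i f p) = axis j 1"
    by (simp add: image_iff Bex_def eq_commute)
  then obtain f where f: "\<And>j. f j \<in> smooth_funs A" and dual: "\<And>j. (\<chi> i. E i (f j) p) = axis j 1"
    unfolding choice_iff by blast
  define M where "M x = (\<chi> j i. E i (f j) x)" for x
  define N where "N x = (\<chi> j i. if i = k then X (f j) x else E i (f j) x)" for x
  have det: "(\<lambda>x. det (\<chi> j i. F j i x)) \<in> smooth_funs A"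
    if F: "\<And>j i. F j i \<in> smooth_funs A" for F :: "'n \<Rightarrow> 'n \<Rightarrow> 'g \<Rightarrow> real"
  proof -
    have "(\<lambda>x. det (\<chi> j i. F j i x)) =
        (\<Sum>\<pi> | \<pi> permutes UNIV. (\<lambda>_. of_int (sign \<pi>)) * (\<Prod>j\<in>UNIV. F j (\<pi> j)))"
    proof
      fix x
      have "prod G I x = (\<Prod>i\<in>I. G i x)" for G :: "'n \<Rightarrow> 'g \<Rightarrow> real" and I
        by (induction I rule: infinite_finite_induct) auto
      moreover have "sum G I x = (\<Sum>i\<in>I. G i x)" for G :: "('n \<Rightarrow> 'n) \<Rightarrow> 'g \<Rightarrow> real" and I
        by (induction I rule: infinite_finite_induct) auto
      ultimately show "det (\<chi> j i. F j i x) =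
          (\<Sum>\<pi> | \<pi> permutes UNIV. (\<lambda>_. of_int (sign \<pi>)) * (\<Prod>j\<in>UNIV. F j (\<pi> j))) x"
        by (simp add: det_def)
    qed
    also have "\<dots> \<in> smooth_funs A"
      by (intro smooth_sum[OF A] smooth_mult[OF A] smooth_prod[OF A] smooth_const F)
    finally show ?thesis .
  qed
  have "M p = mat 1"
    unfolding M_def mat_def using dual by (auto simp: vec_eq_iff axis_def)
  then have "det (M p) \<noteq> 0" by simp
  moreover have "(\<lambda>x. det (M x)) \<in> smooth_funs A"
    unfolding M_def by (intro det vf_smooth[OF A] E)
  moreover have "N x = (\<chi> j i. (if i = k then X (f j) else E i (f j)) x)" for x
    unfolding N_def by (simp add: vec_eq_iff)
  then have "(\<lambda>x. det (N x)) \<in> smooth_funs A"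
    using det[of "\<lambda>j i. if i = k then X (f j) else E i (f j)"] vf_smooth[OF A] E X by simp
  moreover have "c k x * det (M x) = det (N x)" for x
  proof -
    have "N x = (\<chi> j i. if i = k then (M x *v (\<chi> i. c i x)) $ j else M x $ j $ i)"
      unfolding N_def M_def using c[OF f]
      by (simp add: vec_eq_iff matrix_vector_mult_def mult.commute)
    then show ?thesis using cramer_lemma[of k "M x" "\<chi> i. c i x"] by simp
  qed
  ultimately show "\<exists>u\<in>smooth_funs A. \<exists>h\<in>smooth_funs A. h p \<noteq> 0 \<and> (\<forall>x. c k x * h x = u x)"
    by (intro bexI[of _ "\<lambda>x. det (N x)"] bexI[of _ "\<lambda>x. det (M x)"]) auto
qed

text \<open>The algebraic data that all later computations rest on: a global frame of vector fields whose dual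
  1-forms give the coefficients of every vector field,
  so that identities between fields become identities between functions.\<close>

locale coframe =
  fixes A :: "('g::t2_space, 'e::euclidean_space) atlas" and n :: nat
    and \<theta> :: "nat \<Rightarrow> 'g form" and e :: "nat \<Rightarrow> 'g vfield"
  assumes atlas: "smooth_atlas A"
    and frame_vf: "i \<in> {1..n} \<Longrightarrow> e i \<in> vector_fields A"
    and coframe_form: "i \<in> {1..n} \<Longrightarrow> diff_form A 1 (\<theta> i)"
    and dual: "i \<in> {1..n} \<Longrightarrow> j \<in> {1..n} \<Longrightarrow> \<theta> i [e j] = (if i = j then 1 else 0)"
    and expand: "X \<in> vector_fields A \<Longrightarrow> X = (\<Sum>i=1..n. \<theta> i [X] \<odot> e i)"
begin

lemma comp_smooth: "i \<in> {1..n} \<Longrightarrow> X \<in> vector_fields A \<Longrightarrow> \<theta> i [X] \<in> smooth_funs A"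
  using coframe_form[of i] by (simp add: diff_form_def)

end

lemma one_form_add:
  "diff_form A 1 \<alpha> \<Longrightarrow> X \<in> vector_fields A \<Longrightarrow> Y \<in> vector_fields A \<Longrightarrow> \<alpha> [X + Y] = \<alpha> [X] + \<alpha> [Y]"
  unfolding diff_form_def by (drule spec[of _ "[X]"]) simp

lemma one_form_scale:
  "diff_form A 1 \<alpha> \<Longrightarrow> u \<in> smooth_funs A \<Longrightarrow> X \<in> vector_fields A \<Longrightarrow> \<alpha> [u \<odot> X] = u * \<alpha> [X]"
  unfolding diff_form_def by (drule spec[of _ "[X]"]) simp

lemma one_form_sum:
  fixes A :: "('g::t2_space, 'e::euclidean_space) atlas"
  assumes "smooth_atlas A" "diff_form A 1 \<alpha>" "\<And>i. i \<in> I \<Longrightarrow> X i \<in> vector_fields A"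
  shows "\<alpha> [sum X I] = (\<Sum>i\<in>I. \<alpha> [X i])"
proof -
  have "\<alpha> [0 + 0] = \<alpha> [0] + \<alpha> [0]"
    by (intro one_form_add[OF assms(2)] vf_zero assms(1))
  then have "\<alpha> [0] = 0" by simp
  then show ?thesis using assms(3)
    by (induction I rule: infinite_finite_induct) (auto simp: one_form_add[OF assms(2)] vf_sum assms(1))
qed

lemma sum_fun_apply: "sum f I x = (\<Sum>i\<in>I. f i x)"
  by (induction I rule: infinite_finite_induct) auto

text \<open>At each point a vector field is a combination of the \<open>e\<^sub>i\<close>, and its coefficients are smooth by the
  lemma on frames above. The required pointwise independence of the \<open>e\<^sub>i\<close> does not follow from duality at
  once, because the forms act on fields and not on tangent vectors; left invariance supplies it. The type
  \<open>'n\<close> only provides an index set for square matrices of size \<open>n\<close>.\<close>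

lemma left_inv_dual_bases_coframe:
  fixes A :: "('g::{t2_space, second_countable_topology}, 'e::euclidean_space) atlas"
  assumes G: "lie_group A G" and b: "left_inv_dual_bases A G n \<theta> e"
    and n: "n = CARD('n::finite)"
  shows "coframe A n \<theta> e"
proof
  show A: "smooth_atlas A" using G by (simp add: lie_group_def)
  show vf: "e i \<in> vector_fields A" if "i \<in> {1..n}" for i
    using b that by (simp add: left_inv_dual_bases_def left_inv_vfield_def)
  show form: "diff_form A 1 (\<theta> i)" if "i \<in> {1..n}" for i
    using b that by (simp add: left_inv_dual_bases_def left_inv_form_def)
  show dual: "\<theta> i [e j] = (if i = j then 1 else 0)" if "i \<in> {1..n}" "j \<in> {1..n}" for i j
    using b that by (simp add: left_inv_dual_bases_def)
  have comb: "\<theta> j [\<Sum>i=1..n. u i \<odot> e i] = u j"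
    if "j \<in> {1..n}" "\<And>i. i \<in> {1..n} \<Longrightarrow> u i \<in> smooth_funs A" for u j
  proof -
    have "\<theta> j [\<Sum>i=1..n. u i \<odot> e i] = (\<Sum>i=1..n. \<theta> j [u i \<odot> e i])"
      by (intro one_form_sum[OF A form] vf_scale[OF A] vf that)
    also have "\<dots> = (\<Sum>i=1..n. if i = j then u j else 0)"
    proof (intro sum.cong refl)
      fix i assume i: "i \<in> {1..n}"
      show "\<theta> j [u i \<odot> e i] = (if i = j then u j else 0)"
        using one_form_scale[OF form[OF that(1)] that(2)[OF i] vf[OF i]] dual[OF that(1) i] by simp
    qed
    also have "\<dots> = u j" using that(1) by simp
    finally show ?thesis .
  qed
  fix X assume X: "X \<in> vector_fields A"
  have "card (UNIV :: 'n set) = card {1..n}" using n by simp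
  then obtain h where h: "bij_betw h (UNIV :: 'n set) {1..n}"
    using finite_same_card_bij[OF finite finite_atLeastAtMost] by blast
  have hn: "h k \<in> {1..n}" for k using bij_betwE[OF h] by blast
  have reindex: "(\<Sum>i=1..n. F i) = (\<Sum>k\<in>UNIV. F (h k))" for F :: "nat \<Rightarrow> real"
    using sum.reindex_bij_betw[OF h, of F] by simp
  have inv: "group G" "carrier G = UNIV" using G by (auto simp: lie_group_def)
  \<comment> \<open>A linear relation between the \<open>e\<^sub>i\<close> at one point is carried to every point by left translations,
    so that it holds as a relation between vector fields, to which the \<open>\<theta>\<^sub>j\<close> apply.\<close>
  have indep: "a = (\<lambda>_. 0)"
    if a: "\<And>f. f \<in> smooth_funs A \<Longrightarrow> (\<Sum>k\<in>UNIV. a k * e (h k) f p) = 0" for a :: "'n \<Rightarrow> real" and p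
  proof -
    define a' where "a' i = a (inv_into UNIV h i)" for i
    have a'h: "a' (h k) = a k" for k
      using inv_into_f_f[OF bij_betw_imp_inj_on[OF h]] by (simp add: a'_def)
    have zero: "(\<Sum>i=1..n. (\<lambda>_. a' i) \<odot> e i) = 0"
    proof (intro ext)
      fix f x
      define g where "g = x \<otimes>\<^bsub>G\<^esub> inv\<^bsub>G\<^esub> p"
      have g: "inv\<^bsub>G\<^esub> g \<otimes>\<^bsub>G\<^esub> x = p"
        using inv by (simp add: g_def group.inv_mult_group monoid.m_assoc group.is_monoid
            group.inv_inv group.l_inv)
      have "e i f x = e i (\<lambda>y. f (g \<otimes>\<^bsub>G\<^esub> y)) p" if "i \<in> {1..n}" for i
      proof -
        have "left_push G g (e i) = e i"
          using b that by (simp add: left_inv_dual_bases_def left_inv_vfield_def)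
        then have "e i f x = left_push G g (e i) f x" by simp
        then show ?thesis by (simp only: left_push_def g)
      qed
      then have "(\<Sum>i=1..n. (\<lambda>_. a' i) \<odot> e i) f x = (\<Sum>i=1..n. a' i * e i (\<lambda>y. f (g \<otimes>\<^bsub>G\<^esub> y)) p)"
        by (simp add: sum_fun_apply fscale_def)
      also have "\<dots> = (\<Sum>k\<in>UNIV. a k * e (h k) (\<lambda>y. f (g \<otimes>\<^bsub>G\<^esub> y)) p)"
        by (simp only: reindex a'h)
      also have "\<dots> = 0"
        using a[of "\<lambda>y. f (g \<otimes>\<^bsub>G\<^esub> y)"] vf_nonsmooth[OF A vf[OF hn], of "\<lambda>y. f (g \<otimes>\<^bsub>G\<^esub> y)"]
        by (cases "(\<lambda>y. f (g \<otimes>\<^bsub>G\<^esub> y)) \<in> smooth_funs A") auto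
      finally show "(\<Sum>i=1..n. (\<lambda>_. a' i) \<odot> e i) f x = 0 f x" by simp
    qed
    have "a k = 0" for k
    proof -
      have "\<theta> (h k) [\<Sum>i=1..n. (\<lambda>_. a' i) \<odot> e i] = (\<lambda>_. a k)"
        using comb[OF hn, of "\<lambda>i _. a' i" k] by (simp add: smooth_const a'h)
      moreover have "\<theta> (h k) [\<Sum>i=1..n. (\<lambda>_. 0) \<odot> e i] = (\<lambda>_. 0)"
        using comb[OF hn, of "\<lambda>i _. 0" k] by (simp add: smooth_const)
      moreover have "(\<Sum>i=1..n. (\<lambda>_. 0) \<odot> e i) = 0"
        by (simp add: fun_eq_iff sum_fun_apply fscale_def)
      ultimately show ?thesis unfolding zero by (metis)
    qed
    then show ?thesis by auto
  qed
  have "X_at \<in> tangent_space A p" if "X_at = (\<lambda>f. X f p)" for X_at p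
    unfolding that tangent_space_def mem_Collect_eq
    using vf_add_fun[OF A X] vf_mult_fun[OF A X] vf_const[OF A X]
    by (auto simp: smooth_const)
  then have "\<exists>c. \<forall>f\<in>smooth_funs A. X f p = (\<Sum>i=1..n. c i * e i f p)" for p
    using b unfolding left_inv_dual_bases_def by fastforce
  then obtain c where c: "\<And>p f. f \<in> smooth_funs A \<Longrightarrow> X f p = (\<Sum>i=1..n. c p i * e i f p)"
    by metis
  define u where "u i p = c p i" for i p
  have smooth: "u (h k) \<in> smooth_funs A" for k
  proof (rule frame_coefficients_smooth[OF A, where E = "\<lambda>k. e (h k)" and c = "\<lambda>k. u (h k)" and k = k])
    show "e (h k) \<in> vector_fields A" for k by (rule vf[OF hn])
    show "X \<in> vector_fields A" by (rule X)
    show "X f p = (\<Sum>k\<in>UNIV. u (h k) p * e (h k) f p)" if "f \<in> smooth_funs A" for f p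
      using c[OF that] by (simp only: u_def reindex)
  qed (rule indep)
  have "u i \<in> smooth_funs A" if "i \<in> {1..n}" for i
    using smooth h that by (metis bij_betw_imp_surj_on imageE)
  moreover have X_eq: "X = (\<Sum>i=1..n. u i \<odot> e i)"
  proof (intro ext)
    fix f p show "X f p = (\<Sum>i=1..n. u i \<odot> e i) f p"
      by (cases "f \<in> smooth_funs A")
         (simp_all add: c u_def sum_fun_apply fscale_def vf_nonsmooth[OF A] X vf)
  qed
  ultimately have "\<theta> j [X] = u j" if "j \<in> {1..n}" for j
    using comb that by simp
  then show "X = (\<Sum>i=1..n. \<theta> i [X] \<odot> e i)"
    by (subst X_eq) (auto intro: sum.cong)
qed

section \<open>Components with respect to a coframe\<close>

(* Frame indices are literals throughout, so 1 must not be rewritten to Suc 0. *)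
declare One_nat_def [simp del]

lemma sum_1_3: "sum f {1..3::nat} = f 1 + f 2 + f 3"
  by (simp add: eval_nat_numeral atLeastAtMostSuc_conv One_nat_def ac_simps)

lemma sum_1_4: "sum f {1..4::nat} = f 1 + f 2 + f 3 + f 4"
  by (simp add: eval_nat_numeral atLeastAtMostSuc_conv One_nat_def ac_simps)

lemma sum_1_7: "sum f {1..7::nat} = f 1 + f 2 + f 3 + f 4 + f 5 + f 6 + f 7"
  by (simp add: eval_nat_numeral atLeastAtMostSuc_conv One_nat_def ac_simps)

lemma atLeastAtMost_1_3: "{1..3::nat} = {1, 2, 3}" by auto

lemma atLeastAtMost_1_4: "{1..4::nat} = {1, 2, 3, 4}" by auto

lemma atLeastAtMost_1_7: "{1..7::nat} = {1, 2, 3, 4, 5, 6, 7}" by auto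

lemma ball_1_3: "(\<forall>i\<in>{1..3::nat}. P i) \<longleftrightarrow> P 1 \<and> P 2 \<and> P 3"
  by (simp add: atLeastAtMost_1_3)

lemma ball_1_4: "(\<forall>i\<in>{1..4::nat}. P i) \<longleftrightarrow> P 1 \<and> P 2 \<and> P 3 \<and> P 4"
  by (simp add: atLeastAtMost_1_4)

lemma ball_1_7: "(\<forall>i\<in>{1..7::nat}. P i) \<longleftrightarrow> P 1 \<and> P 2 \<and> P 3 \<and> P 4 \<and> P 5 \<and> P 6 \<and> P 7"
  by (simp add: atLeastAtMost_1_7)

lemma cowedge_eq: "cowedge \<theta> i j [X, Y] = \<theta> i [X] * \<theta> j [Y] - \<theta> i [Y] * \<theta> j [X]"
  by (simp add: cowedge_def wedge_1_1[unfolded One_nat_def] One_nat_def)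

context coframe
begin

lemmas smooth_intros = smooth_const smooth_zero[OF atlas] smooth_one[OF atlas] smooth_add[OF atlas]
  smooth_diff[OF atlas] smooth_uminus[OF atlas] smooth_mult[OF atlas] vf_smooth[OF atlas] comp_smooth

lemmas vf_intros = vf_add[OF atlas] vf_scale[OF atlas] vf_zero[OF atlas] vf_uminus[OF atlas]
  vf_diff[OF atlas] vf_bracket[OF atlas] frame_vf

lemmas derivation = vf_add_fun[OF atlas] vf_diff_fun[OF atlas] vf_uminus_fun[OF atlas]
  vf_mult_fun[OF atlas] vf_zero_fun[OF atlas] vf_one_fun[OF atlas] vf_const[OF atlas]

lemma comp_add:
  "i \<in> {1..n} \<Longrightarrow> X \<in> vector_fields A \<Longrightarrow> Y \<in> vector_fields A \<Longrightarrow> \<theta> i [X + Y] = \<theta> i [X] + \<theta> i [Y]"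
  by (rule one_form_add[OF coframe_form])

lemma comp_scale:
  "i \<in> {1..n} \<Longrightarrow> u \<in> smooth_funs A \<Longrightarrow> X \<in> vector_fields A \<Longrightarrow> \<theta> i [u \<odot> X] = u * \<theta> i [X]"
  by (rule one_form_scale[OF coframe_form])

lemma comp_zero: "i \<in> {1..n} \<Longrightarrow> \<theta> i [0] = 0"
  using comp_add[of i 0 0] vf_zero[OF atlas] by simp

lemma comp_uminus: "i \<in> {1..n} \<Longrightarrow> X \<in> vector_fields A \<Longrightarrow> \<theta> i [- X] = - \<theta> i [X]"
  using comp_add[of i X "- X"] vf_uminus[OF atlas, of X] comp_zero[of i] by (simp add: add_eq_0_iff)

lemma comp_diff:
  assumes "i \<in> {1..n}" "X \<in> vector_fields A" "Y \<in> vector_fields A"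
  shows "\<theta> i [X - Y] = \<theta> i [X] - \<theta> i [Y]"
  using comp_add[of i "X - Y" Y] assms vf_diff[OF atlas, of X Y] by simp

lemma comp_bracket: "\<theta> i [lie_bracket X Y] = X (\<theta> i [Y]) - Y (\<theta> i [X]) - ext_d (\<theta> i) [X, Y]"
  by (simp add: ext_d_1)

lemmas comp_simps = comp_add comp_scale comp_zero comp_uminus comp_diff comp_bracket dual

lemma vf_eqI:
  assumes "X \<in> vector_fields A" "Y \<in> vector_fields A" "\<And>i. i \<in> {1..n} \<Longrightarrow> \<theta> i [X] = \<theta> i [Y]"
  shows "X = Y"
  using expand[OF assms(1)] expand[OF assms(2)] assms(3) by (metis (no_types, lifting) sum.cong)

end

section \<open>The qc structure of a coframe\<close>

locale coframe7 = coframe A 7 \<theta> e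
  for A :: "('g::t2_space, 'e::euclidean_space) atlas" and \<theta> :: "nat \<Rightarrow> 'g form"
    and e :: "nat \<Rightarrow> 'g vfield" +
  fixes Q :: "'g qc"
  assumes Q: "Q = coframe_qc A \<theta> e"
begin

lemma met_eq: "met Q X Y = \<theta> 1 [X] * \<theta> 1 [Y] + \<theta> 2 [X] * \<theta> 2 [Y] + \<theta> 3 [X] * \<theta> 3 [Y] + \<theta> 4 [X] * \<theta> 4 [Y]"
  by (simp add: Q coframe_qc_def sum_1_4)

lemma eta_eq: "eta Q 1 = \<theta> 5" "eta Q 2 = \<theta> 6" "eta Q 3 = \<theta> 7"
  by (simp_all add: Q coframe_qc_def)

lemma reeb_eq: "reeb Q 1 = e 5" "reeb Q 2 = e 6" "reeb Q 3 = e 7"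
  by (simp_all add: Q coframe_qc_def)

lemma hor_iff: "X \<in> hor Q \<longleftrightarrow> X \<in> vector_fields A \<and> \<theta> 5 [X] = 0 \<and> \<theta> 6 [X] = 0 \<and> \<theta> 7 [X] = 0"
proof
  assume "X \<in> hor Q"
  then obtain u where u: "\<forall>a\<in>{1..4}. u a \<in> smooth_funs A" and X: "X = (\<Sum>a=1..4. u a \<odot> e a)"
    by (auto simp: Q coframe_qc_def)
  show "X \<in> vector_fields A \<and> \<theta> 5 [X] = 0 \<and> \<theta> 6 [X] = 0 \<and> \<theta> 7 [X] = 0"
    using u unfolding X sum_1_4 ball_1_4 by (simp add: vf_intros comp_simps)
next
  assume "X \<in> vector_fields A \<and> \<theta> 5 [X] = 0 \<and> \<theta> 6 [X] = 0 \<and> \<theta> 7 [X] = 0"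
  then have X: "X \<in> vector_fields A" and zero: "\<theta> 5 [X] = 0" "\<theta> 6 [X] = 0" "\<theta> 7 [X] = 0" by auto
  have "X = (\<Sum>a=1..4. \<theta> a [X] \<odot> e a)"
    by (rule vf_eqI[OF X])
       (use X zero in \<open>auto simp: sum_1_4 atLeastAtMost_1_7 vf_intros comp_simps comp_smooth\<close>)
  then show "X \<in> hor Q"
    unfolding Q coframe_qc_def using comp_smooth X by auto
qed

lemma hor_vf: "X \<in> hor Q \<Longrightarrow> X \<in> vector_fields A" by (simp add: hor_iff)

lemma hor_comps: "X \<in> hor Q \<Longrightarrow> \<theta> 5 [X] = 0" "X \<in> hor Q \<Longrightarrow> \<theta> 6 [X] = 0" "X \<in> hor Q \<Longrightarrow> \<theta> 7 [X] = 0"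
  by (simp_all add: hor_iff)

lemma acs_eq: "acs Q r X = coframe_omega \<theta> r [X, e 1] \<odot> e 1 + coframe_omega \<theta> r [X, e 2] \<odot> e 2 +
    coframe_omega \<theta> r [X, e 3] \<odot> e 3 + coframe_omega \<theta> r [X, e 4] \<odot> e 4"
  by (simp add: Q coframe_qc_def sum_1_4)

lemma coframe_omega_smooth:
  "X \<in> vector_fields A \<Longrightarrow> Y \<in> vector_fields A \<Longrightarrow> coframe_omega \<theta> r [X, Y] \<in> smooth_funs A"
  by (simp add: coframe_omega_def cowedge_eq smooth_intros)

lemma acs_vf: "X \<in> vector_fields A \<Longrightarrow> acs Q r X \<in> vector_fields A"
  by (simp add: acs_eq vf_intros coframe_omega_smooth)

text \<open>The vector fields \<open>I\<^sub>r X\<close> in components: left multiplication by the imaginary units on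
  \<open>H = span{e\<^sub>1, \<dots>, e\<^sub>4}\<close>, regarded as the quaternions.\<close>

lemma acs_comps:
  assumes "X \<in> vector_fields A"
  shows "\<theta> 1 [acs Q 1 X] = - \<theta> 2 [X]" "\<theta> 2 [acs Q 1 X] = \<theta> 1 [X]"
    "\<theta> 3 [acs Q 1 X] = - \<theta> 4 [X]" "\<theta> 4 [acs Q 1 X] = \<theta> 3 [X]"
    "\<theta> 1 [acs Q 2 X] = - \<theta> 3 [X]" "\<theta> 2 [acs Q 2 X] = \<theta> 4 [X]"
    "\<theta> 3 [acs Q 2 X] = \<theta> 1 [X]" "\<theta> 4 [acs Q 2 X] = - \<theta> 2 [X]"
    "\<theta> 1 [acs Q 3 X] = - \<theta> 4 [X]" "\<theta> 2 [acs Q 3 X] = - \<theta> 3 [X]"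
    "\<theta> 3 [acs Q 3 X] = \<theta> 2 [X]" "\<theta> 4 [acs Q 3 X] = \<theta> 1 [X]"
    "\<theta> 5 [acs Q r X] = 0" "\<theta> 6 [acs Q r X] = 0" "\<theta> 7 [acs Q r X] = 0"
proof -
  note s = coframe_omega_smooth[OF assms]
  show "\<theta> 5 [acs Q r X] = 0" "\<theta> 6 [acs Q r X] = 0" "\<theta> 7 [acs Q r X] = 0"
    using assms by (simp_all add: acs_eq comp_simps s vf_intros)
  have "\<theta> i [acs Q r X] = coframe_omega \<theta> r [X, e i]" if "i \<in> {1..4}" for i r
    using that assms by (auto simp: atLeastAtMost_1_4 acs_eq comp_simps s vf_intros)
  then show "\<theta> 1 [acs Q 1 X] = - \<theta> 2 [X]" "\<theta> 2 [acs Q 1 X] = \<theta> 1 [X]"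
    "\<theta> 3 [acs Q 1 X] = - \<theta> 4 [X]" "\<theta> 4 [acs Q 1 X] = \<theta> 3 [X]"
    "\<theta> 1 [acs Q 2 X] = - \<theta> 3 [X]" "\<theta> 2 [acs Q 2 X] = \<theta> 4 [X]"
    "\<theta> 3 [acs Q 2 X] = \<theta> 1 [X]" "\<theta> 4 [acs Q 2 X] = - \<theta> 2 [X]"
    "\<theta> 1 [acs Q 3 X] = - \<theta> 4 [X]" "\<theta> 2 [acs Q 3 X] = - \<theta> 3 [X]"
    "\<theta> 3 [acs Q 3 X] = \<theta> 2 [X]" "\<theta> 4 [acs Q 3 X] = \<theta> 1 [X]"
    by (simp_all add: coframe_omega_def cowedge_eq dual)
qed

lemma acs_hor: "X \<in> vector_fields A \<Longrightarrow> acs Q r X \<in> hor Q"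
  by (simp add: hor_iff acs_vf acs_comps)

lemma hor_metric: "hor_metric A Q"
  unfolding hor_metric_def
proof (intro conjI ballI allI impI)
  fix X p assume X: "X \<in> hor Q"
  show "met Q X X p \<ge> 0" by (simp add: met_eq)
  fix f assume "met Q X X p = 0"
  then have "\<theta> 1 [X] p * \<theta> 1 [X] p + \<theta> 2 [X] p * \<theta> 2 [X] p + \<theta> 3 [X] p * \<theta> 3 [X] p +
      \<theta> 4 [X] p * \<theta> 4 [X] p = 0"
    by (simp add: met_eq)
  then have "\<theta> 1 [X] p = 0 \<and> \<theta> 2 [X] p = 0 \<and> \<theta> 3 [X] p = 0 \<and> \<theta> 4 [X] p = 0"
    by (smt (verit) zero_le_square mult_eq_0_iff)
  moreover have "\<theta> 5 [X] p = 0" "\<theta> 6 [X] p = 0" "\<theta> 7 [X] p = 0"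
    using X by (simp_all add: hor_comps)
  ultimately show "X f p = 0"
    by (subst expand[OF hor_vf[OF X]]) (simp add: sum_1_7 fscale_def)
qed (auto simp: met_eq comp_simps hor_vf smooth_intros algebra_simps)

lemma frame_hor: "a \<in> {1..4} \<Longrightarrow> e a \<in> hor Q"
  by (auto simp: hor_iff frame_vf dual)

lemma hor_orthonormal_frame: "hor_orthonormal_frame Q e"
proof -
  have "X = (\<Sum>a=1..4. met Q X (e a) \<odot> e a)" if X: "X \<in> hor Q" for X
    by (rule vf_eqI)
       (use X hor_vf[OF X] in \<open>auto simp: sum_1_4 atLeastAtMost_1_7 vf_intros comp_simps smooth_intros
          met_eq hor_comps\<close>)
  moreover have "\<forall>a\<in>{1..4}. e a \<in> hor Q" by (simp add: frame_hor)
  moreover have "\<forall>a\<in>{1..4}. \<forall>b\<in>{1..4}. met Q (e a) (e b) = (if a = b then 1 else 0)"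
    by (simp add: ball_1_4 met_eq dual)
  ultimately show ?thesis unfolding hor_orthonormal_frame_def by blast
qed

lemma hor_intros:
  "X \<in> hor Q \<Longrightarrow> Y \<in> hor Q \<Longrightarrow> X + Y \<in> hor Q"
  "X \<in> hor Q \<Longrightarrow> Y \<in> hor Q \<Longrightarrow> X - Y \<in> hor Q"
  "X \<in> hor Q \<Longrightarrow> - X \<in> hor Q"
  "u \<in> smooth_funs A \<Longrightarrow> X \<in> hor Q \<Longrightarrow> u \<odot> X \<in> hor Q"
  by (auto simp: hor_iff vf_intros comp_simps)

lemma hor_eqI:
  assumes "X \<in> hor Q" "Y \<in> hor Q" "\<theta> 1 [X] = \<theta> 1 [Y]" "\<theta> 2 [X] = \<theta> 2 [Y]"
    "\<theta> 3 [X] = \<theta> 3 [Y]" "\<theta> 4 [X] = \<theta> 4 [Y]"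
  shows "X = Y"
  by (rule vf_eqI) (use assms in \<open>auto simp: atLeastAtMost_1_7 hor_vf hor_comps\<close>)

lemma acs_add:
  assumes "X \<in> vector_fields A" "Y \<in> vector_fields A" "r \<in> {1..3}"
  shows "acs Q r (X + Y) = acs Q r X + acs Q r Y"
  using assms(3) unfolding atLeastAtMost_1_3
  by (auto intro!: hor_eqI hor_intros acs_hor vf_intros assms(1,2)
      simp: comp_simps acs_comps assms(1,2) vf_intros acs_vf)

lemma acs_scale:
  assumes "X \<in> vector_fields A" "u \<in> smooth_funs A" "r \<in> {1..3}"
  shows "acs Q r (u \<odot> X) = u \<odot> acs Q r X"
  using assms(3) unfolding atLeastAtMost_1_3
  by (auto intro!: hor_eqI hor_intros acs_hor vf_intros assms(1,2)
      simp: comp_simps acs_comps assms(1,2) vf_intros acs_vf)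

lemma acs_quaternion:
  assumes X: "X \<in> hor Q"
  shows "acs Q 1 (acs Q 2 X) = acs Q 3 X" "acs Q 2 (acs Q 1 X) = - acs Q 3 X"
    "acs Q 1 (acs Q 2 (acs Q 3 X)) = - X"
    "r \<in> {1..3} \<Longrightarrow> acs Q r (acs Q r X) = - X"
proof -
  note s = comp_simps acs_comps vf_intros acs_vf hor_vf[OF X]
  show "acs Q 1 (acs Q 2 X) = acs Q 3 X"
    by (intro hor_eqI acs_hor acs_vf hor_vf[OF X]) (simp_all add: s)
  show "acs Q 2 (acs Q 1 X) = - acs Q 3 X"
    by (intro hor_eqI hor_intros acs_hor acs_vf hor_vf[OF X]) (simp_all add: s)
  show "acs Q 1 (acs Q 2 (acs Q 3 X)) = - X"
    by (intro hor_eqI hor_intros acs_hor acs_vf hor_vf[OF X] X) (simp_all add: s)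
  show "acs Q r (acs Q r X) = - X" if "r \<in> {1..3}"
    using that unfolding atLeastAtMost_1_3
    by (auto intro!: hor_eqI hor_intros acs_hor acs_vf hor_vf[OF X] X simp: s)
qed

lemma acs_isometry:
  assumes "X \<in> vector_fields A" "Y \<in> vector_fields A" "r \<in> {1..3}"
  shows "met Q (acs Q r X) (acs Q r Y) = met Q X Y"
  using assms(3) unfolding atLeastAtMost_1_3 by (auto simp: met_eq acs_comps assms(1,2))

lemma met_acs:
  assumes "X \<in> vector_fields A"
  shows
    "met Q (acs Q 1 X) Y p = \<theta> 1 [X] p * \<theta> 2 [Y] p - \<theta> 2 [X] p * \<theta> 1 [Y] p
      + \<theta> 3 [X] p * \<theta> 4 [Y] p - \<theta> 4 [X] p * \<theta> 3 [Y] p"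
    "met Q (acs Q 2 X) Y p = \<theta> 1 [X] p * \<theta> 3 [Y] p - \<theta> 3 [X] p * \<theta> 1 [Y] p
      + \<theta> 4 [X] p * \<theta> 2 [Y] p - \<theta> 2 [X] p * \<theta> 4 [Y] p"
    "met Q (acs Q 3 X) Y p = \<theta> 1 [X] p * \<theta> 4 [Y] p - \<theta> 4 [X] p * \<theta> 1 [Y] p
      + \<theta> 2 [X] p * \<theta> 3 [Y] p - \<theta> 3 [X] p * \<theta> 2 [Y] p"
  using assms by (simp_all add: met_eq acs_comps)

end

section \<open>The structure equations\<close>

text \<open>The structure equations evaluated on arbitrary vector fields, not only on the frame. In this form
  they express the components of a bracket \<open>[X, Y]\<close> through those of \<open>X\<close> and \<open>Y\<close>, so identities between
  components can be verified without a reduction to the frame.\<close>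

locale g2_coframe = coframe7 A \<theta> e Q
  for A :: "('g::t2_space, 'e::euclidean_space) atlas" and \<theta> :: "nat \<Rightarrow> 'g form"
    and e :: "nat \<Rightarrow> 'g vfield" and Q :: "'g qc" +
  assumes d1: "X \<in> vector_fields A \<Longrightarrow> Y \<in> vector_fields A \<Longrightarrow> ext_d (\<theta> 1) [X, Y] p = 0"
    and d2: "X \<in> vector_fields A \<Longrightarrow> Y \<in> vector_fields A \<Longrightarrow> ext_d (\<theta> 2) [X, Y] p =
      (2/3) * (\<theta> 1 [X] p * \<theta> 2 [Y] p - \<theta> 1 [Y] p * \<theta> 2 [X] p)
      + (1/6) * (\<theta> 1 [X] p * \<theta> 5 [Y] p - \<theta> 1 [Y] p * \<theta> 5 [X] p)
      - (1/3) * (\<theta> 3 [X] p * \<theta> 4 [Y] p - \<theta> 3 [Y] p * \<theta> 4 [X] p)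
      + (1/6) * (\<theta> 4 [X] p * \<theta> 6 [Y] p - \<theta> 4 [Y] p * \<theta> 6 [X] p)"
    and d3: "X \<in> vector_fields A \<Longrightarrow> Y \<in> vector_fields A \<Longrightarrow> ext_d (\<theta> 3) [X, Y] p =
      - (2/3) * (\<theta> 1 [X] p * \<theta> 3 [Y] p - \<theta> 1 [Y] p * \<theta> 3 [X] p)
      + (1/6) * (\<theta> 1 [X] p * \<theta> 6 [Y] p - \<theta> 1 [Y] p * \<theta> 6 [X] p)
      - (\<theta> 2 [X] p * \<theta> 4 [Y] p - \<theta> 2 [Y] p * \<theta> 4 [X] p)
      - (1/6) * (\<theta> 4 [X] p * \<theta> 5 [Y] p - \<theta> 4 [Y] p * \<theta> 5 [X] p)"
    and d4: "X \<in> vector_fields A \<Longrightarrow> Y \<in> vector_fields A \<Longrightarrow> ext_d (\<theta> 4) [X, Y] p =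
      - (2/3) * (\<theta> 1 [X] p * \<theta> 4 [Y] p - \<theta> 1 [Y] p * \<theta> 4 [X] p)"
    and d5: "X \<in> vector_fields A \<Longrightarrow> Y \<in> vector_fields A \<Longrightarrow> ext_d (\<theta> 5) [X, Y] p =
      2 * (\<theta> 1 [X] p * \<theta> 2 [Y] p - \<theta> 1 [Y] p * \<theta> 2 [X] p)
      + 2 * (\<theta> 3 [X] p * \<theta> 4 [Y] p - \<theta> 3 [Y] p * \<theta> 4 [X] p)
      - (\<theta> 4 [X] p * \<theta> 6 [Y] p - \<theta> 4 [Y] p * \<theta> 6 [X] p)"
    and d6: "X \<in> vector_fields A \<Longrightarrow> Y \<in> vector_fields A \<Longrightarrow> ext_d (\<theta> 6) [X, Y] p =
      2 * (\<theta> 1 [X] p * \<theta> 3 [Y] p - \<theta> 1 [Y] p * \<theta> 3 [X] p)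
      + 2 * (\<theta> 4 [X] p * \<theta> 2 [Y] p - \<theta> 4 [Y] p * \<theta> 2 [X] p)
      + (\<theta> 4 [X] p * \<theta> 5 [Y] p - \<theta> 4 [Y] p * \<theta> 5 [X] p)"
    and d7: "X \<in> vector_fields A \<Longrightarrow> Y \<in> vector_fields A \<Longrightarrow> ext_d (\<theta> 7) [X, Y] p =
      2 * (\<theta> 1 [X] p * \<theta> 4 [Y] p - \<theta> 1 [Y] p * \<theta> 4 [X] p)
      + 2 * (\<theta> 2 [X] p * \<theta> 3 [Y] p - \<theta> 2 [Y] p * \<theta> 3 [X] p)
      - (1/6) * (\<theta> 5 [X] p * \<theta> 6 [Y] p - \<theta> 5 [Y] p * \<theta> 6 [X] p)"
begin

lemmas structure_equations = d1 d2 d3 d4 d5 d6 d7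

text \<open>Restricted to \<open>H\<close> the three forms \<open>d\<theta>\<^sub>5\<close>, \<open>d\<theta>\<^sub>6\<close>, \<open>d\<theta>\<^sub>7\<close> are \<open>2\<omega>\<^sub>1\<close>, \<open>2\<omega>\<^sub>2\<close>, \<open>2\<omega>\<^sub>3\<close>; of their
  remaining terms only \<open>- e\<^sup>4\<^sup>6\<close> and \<open>e\<^sup>4\<^sup>5\<close> mix \<open>H\<close> and \<open>V\<close>, and these give the antisymmetry required of
  the Reeb fields.\<close>

theorem integrable_qc: "integrable_qc A Q"
  unfolding integrable_qc_def
proof (intro conjI)
  show "\<forall>r\<in>{1..3}. diff_form A 1 (eta Q r)"
    by (simp add: ball_1_3 eta_eq coframe_form)
  show "hor Q = {X \<in> vector_fields A. \<forall>r\<in>{1..3}. eta Q r [X] = 0}"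
    by (simp add: set_eq_iff hor_iff ball_1_3 eta_eq)
  show "hor_metric A Q" by (rule hor_metric)
  show "\<exists>E. hor_orthonormal_frame Q E" using hor_orthonormal_frame by blast
  show "\<forall>r\<in>{1..3}. hor_endo A Q (acs Q r)"
    by (simp add: hor_endo_def acs_hor acs_add acs_scale hor_vf)
  show "\<forall>r\<in>{1..3}. \<forall>X\<in>hor Q. acs Q r (acs Q r X) = - X" by (simp add: acs_quaternion(4))
  show "\<forall>X\<in>hor Q. acs Q 1 (acs Q 2 X) = acs Q 3 X \<and> acs Q 2 (acs Q 1 X) = - acs Q 3 X \<and>
        acs Q 1 (acs Q 2 (acs Q 3 X)) = - X" by (simp add: acs_quaternion(1-3))
  show "\<forall>r\<in>{1..3}. \<forall>X\<in>hor Q. \<forall>Y\<in>hor Q.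
      met Q (acs Q r X) (acs Q r Y) = met Q X Y \<and>
      2 * met Q (acs Q r X) Y = ext_d (eta Q r) [X, Y]"
    unfolding ball_1_3 eta_eq
    by (auto simp: acs_isometry hor_vf fun_eq_iff structure_equations hor_comps met_acs algebra_simps)
  show "\<forall>r\<in>{1..3}. reeb Q r \<in> vector_fields A"
    by (simp add: ball_1_3 reeb_eq frame_vf)
  show "\<forall>s\<in>{1..3}. \<forall>k\<in>{1..3}. eta Q s [reeb Q k] = (if s = k then 1 else 0)"
    by (simp add: ball_1_3 eta_eq reeb_eq dual)
  show "\<forall>s\<in>{1..3}. \<forall>X\<in>hor Q. ext_d (eta Q s) [reeb Q s, X] = 0"
    by (simp add: ball_1_3 eta_eq reeb_eq fun_eq_iff structure_equations hor_vf hor_comps frame_vf dual)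
  show "\<forall>s\<in>{1..3}. \<forall>k\<in>{1..3}. \<forall>X\<in>hor Q.
      ext_d (eta Q k) [reeb Q s, X] = - ext_d (eta Q s) [reeb Q k, X]"
    by (simp add: ball_1_3 eta_eq reeb_eq fun_eq_iff structure_equations hor_vf hor_comps frame_vf dual)
qed

end

section \<open>Projections, vertical fields and the map \<open>\<phi>\<close>\<close>

lemma fscale_apply: "(u \<odot> X) f = u * X f"
  by (simp add: fscale_def)

context coframe7
begin

lemma vproj_eq: "vproj Q X = \<theta> 5 [X] \<odot> e 5 + \<theta> 6 [X] \<odot> e 6 + \<theta> 7 [X] \<odot> e 7"
  by (simp add: vproj_def sum_1_3 eta_eq reeb_eq)

lemma vproj_vf: "X \<in> vector_fields A \<Longrightarrow> vproj Q X \<in> vector_fields A"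
  by (simp add: vproj_eq vf_intros comp_smooth)

lemma vproj_comps:
  assumes "X \<in> vector_fields A"
  shows "\<theta> 1 [vproj Q X] = 0" "\<theta> 2 [vproj Q X] = 0" "\<theta> 3 [vproj Q X] = 0" "\<theta> 4 [vproj Q X] = 0"
    "\<theta> 5 [vproj Q X] = \<theta> 5 [X]" "\<theta> 6 [vproj Q X] = \<theta> 6 [X]" "\<theta> 7 [vproj Q X] = \<theta> 7 [X]"
  using assms by (simp_all add: vproj_eq vf_intros comp_smooth comp_simps)

lemma hproj_vf: "X \<in> vector_fields A \<Longrightarrow> hproj Q X \<in> vector_fields A"
  by (simp add: hproj_def vproj_vf vf_intros)

lemma hproj_comps:
  assumes "X \<in> vector_fields A"
  shows "\<theta> 1 [hproj Q X] = \<theta> 1 [X]" "\<theta> 2 [hproj Q X] = \<theta> 2 [X]" "\<theta> 3 [hproj Q X] = \<theta> 3 [X]"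
    "\<theta> 4 [hproj Q X] = \<theta> 4 [X]" "\<theta> 5 [hproj Q X] = 0" "\<theta> 6 [hproj Q X] = 0" "\<theta> 7 [hproj Q X] = 0"
  using assms by (simp_all add: hproj_def vproj_vf vproj_comps comp_simps)

lemma ext_met_eq:
  assumes "X \<in> vector_fields A" "Y \<in> vector_fields A"
  shows "ext_met Q X Y = \<theta> 1 [X] * \<theta> 1 [Y] + \<theta> 2 [X] * \<theta> 2 [Y] + \<theta> 3 [X] * \<theta> 3 [Y] + \<theta> 4 [X] * \<theta> 4 [Y]
    + (\<theta> 5 [X] * \<theta> 5 [Y] + \<theta> 6 [X] * \<theta> 6 [Y] + \<theta> 7 [X] * \<theta> 7 [Y])"
  using assms by (simp add: ext_met_def met_eq hproj_comps sum_1_3 eta_eq)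

lemma vert_iff: "X \<in> vert A Q \<longleftrightarrow>
  X \<in> vector_fields A \<and> \<theta> 1 [X] = 0 \<and> \<theta> 2 [X] = 0 \<and> \<theta> 3 [X] = 0 \<and> \<theta> 4 [X] = 0"
proof
  assume "X \<in> vert A Q"
  then obtain u where u: "\<forall>r\<in>{1..3}. u r \<in> smooth_funs A" and X: "X = (\<Sum>r=1..3. u r \<odot> reeb Q r)"
    by (auto simp: vert_def)
  show "X \<in> vector_fields A \<and> \<theta> 1 [X] = 0 \<and> \<theta> 2 [X] = 0 \<and> \<theta> 3 [X] = 0 \<and> \<theta> 4 [X] = 0"
    using u unfolding X sum_1_3 ball_1_3 reeb_eq by (simp add: vf_intros comp_simps)
next
  assume *: "X \<in> vector_fields A \<and> \<theta> 1 [X] = 0 \<and> \<theta> 2 [X] = 0 \<and> \<theta> 3 [X] = 0 \<and> \<theta> 4 [X] = 0"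
  then have X: "X \<in> vector_fields A" by blast
  have "X = (\<Sum>r=1..3. \<theta> (4 + r) [X] \<odot> reeb Q r)"
    by (rule vf_eqI[OF X])
       (use * in \<open>auto simp: sum_1_3 reeb_eq atLeastAtMost_1_7 vf_intros comp_simps comp_smooth\<close>)
  moreover have "\<forall>r\<in>{1..3}. \<theta> (4 + r) [X] \<in> smooth_funs A"
    using X by (simp add: ball_1_3 comp_smooth)
  ultimately show "X \<in> vert A Q" unfolding vert_def mem_Collect_eq by (intro exI conjI)
qed

lemma vert_vf: "X \<in> vert A Q \<Longrightarrow> X \<in> vector_fields A" by (simp add: vert_iff)

lemma vert_comps:
  "X \<in> vert A Q \<Longrightarrow> \<theta> 1 [X] = 0" "X \<in> vert A Q \<Longrightarrow> \<theta> 2 [X] = 0"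
  "X \<in> vert A Q \<Longrightarrow> \<theta> 3 [X] = 0" "X \<in> vert A Q \<Longrightarrow> \<theta> 4 [X] = 0"
  by (simp_all add: vert_iff)

lemma phi_eq: "phi Q \<xi> X = \<theta> 5 [\<xi>] \<odot> acs Q 1 X + \<theta> 6 [\<xi>] \<odot> acs Q 2 X + \<theta> 7 [\<xi>] \<odot> acs Q 3 X"
  by (simp add: phi_def sum_1_3 eta_eq)

lemma phi_hor: "\<xi> \<in> vector_fields A \<Longrightarrow> X \<in> vector_fields A \<Longrightarrow> phi Q \<xi> X \<in> hor Q"
  unfolding phi_eq by (intro hor_intros acs_hor comp_smooth) auto

lemma phi_comps:
  assumes "\<xi> \<in> vector_fields A" "X \<in> vector_fields A"
  shows "\<theta> 1 [phi Q \<xi> X] = - (\<theta> 5 [\<xi>] * \<theta> 2 [X]) - \<theta> 6 [\<xi>] * \<theta> 3 [X] - \<theta> 7 [\<xi>] * \<theta> 4 [X]"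
    "\<theta> 2 [phi Q \<xi> X] = \<theta> 5 [\<xi>] * \<theta> 1 [X] + \<theta> 6 [\<xi>] * \<theta> 4 [X] - \<theta> 7 [\<xi>] * \<theta> 3 [X]"
    "\<theta> 3 [phi Q \<xi> X] = - (\<theta> 5 [\<xi>] * \<theta> 4 [X]) + \<theta> 6 [\<xi>] * \<theta> 1 [X] + \<theta> 7 [\<xi>] * \<theta> 2 [X]"
    "\<theta> 4 [phi Q \<xi> X] = \<theta> 5 [\<xi>] * \<theta> 3 [X] - \<theta> 6 [\<xi>] * \<theta> 2 [X] + \<theta> 7 [\<xi>] * \<theta> 1 [X]"
  using assms by (simp_all add: phi_eq comp_simps acs_comps acs_vf vf_intros comp_smooth)

text \<open>Both \<open>sp(1)\<close> summands consist of skew endomorphisms, so for the trace condition on the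
  torsion of a connection its symmetry is sufficient.\<close>

lemma endo_inner_symmetric_skew:
  assumes E: "hor_orthonormal_frame Q E"
    and T: "\<And>X. X \<in> hor Q \<Longrightarrow> T X \<in> hor Q" and B: "\<And>X. X \<in> hor Q \<Longrightarrow> B X \<in> hor Q"
    and sym: "\<And>X Y. X \<in> hor Q \<Longrightarrow> Y \<in> hor Q \<Longrightarrow> met Q (T X) Y = met Q X (T Y)"
    and skew: "\<And>X Y. X \<in> hor Q \<Longrightarrow> Y \<in> hor Q \<Longrightarrow> met Q (B X) Y = - met Q X (B Y)"
  shows "endo_inner Q E T B = 0"
proof -
  have hor: "E a \<in> hor Q" if "a \<in> {1..4}" for a
    using E that by (simp add: hor_orthonormal_frame_def)
  have met_sym: "met Q X Y = met Q Y X" for X Y by (simp add: met_eq mult.commute)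
  have parseval: "met Q X Y = (\<Sum>b=1..4. met Q X (E b) * met Q Y (E b))"
    if X: "X \<in> hor Q" and Y: "Y \<in> hor Q" for X Y
  proof -
    have Y_eq: "Y = (\<Sum>b=1..4. met Q Y (E b) \<odot> E b)"
      using E Y unfolding hor_orthonormal_frame_def by blast
    have s: "met Q Y (E b) \<in> smooth_funs A" if "b \<in> {1..4}" for b
      using hor_metric Y hor[OF that] unfolding hor_metric_def by blast
    have "met Q X (\<Sum>b=1..4. y b \<odot> E b) = (\<Sum>b=1..4. met Q X (E b) * y b)"
      if y: "\<And>b. b \<in> {1..4} \<Longrightarrow> y b \<in> smooth_funs A" for y
    proof -
      have y': "y 1 \<in> smooth_funs A" "y 2 \<in> smooth_funs A" "y 3 \<in> smooth_funs A" "y 4 \<in> smooth_funs A"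
        using y by auto
      have E': "E 1 \<in> vector_fields A" "E 2 \<in> vector_fields A" "E 3 \<in> vector_fields A" "E 4 \<in> vector_fields A"
        using hor hor_vf by auto
      show ?thesis
        by (simp add: sum_1_4 met_eq comp_simps vf_intros y' E') (simp add: algebra_simps)
    qed
    from this[of "\<lambda>b. met Q Y (E b)", OF s]
    have "met Q X (\<Sum>b=1..4. met Q Y (E b) \<odot> E b) = (\<Sum>b=1..4. met Q X (E b) * met Q Y (E b))" .
    then show ?thesis by (subst (asm) Y_eq[symmetric])
  qed
  define F where "F a b = met Q (T (E a)) (E b) * met Q (B (E a)) (E b)" for a b
  have "F a b = - F b a" if a: "a \<in> {1..4}" and b: "b \<in> {1..4}" for a b
  proof -
    have "met Q (T (E a)) (E b) = met Q (T (E b)) (E a)"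
      by (rule trans[OF sym[OF hor[OF a] hor[OF b]] met_sym])
    moreover have "met Q (B (E a)) (E b) = - met Q (B (E b)) (E a)"
      by (rule trans[OF skew[OF hor[OF a] hor[OF b]] arg_cong[OF met_sym, of uminus]])
    ultimately show ?thesis by (simp add: F_def)
  qed
  then have "(\<Sum>a=1..4. \<Sum>b=1..4. F a b) = (\<Sum>a=1..4. \<Sum>b=1..4. - F b a)"
    by (intro sum.cong refl)
  then have anti: "(\<Sum>a=1..4. \<Sum>b=1..4. F a b) = - (\<Sum>a=1..4. \<Sum>b=1..4. F b a)"
    by (simp only: sum_negf)
  moreover have "v = 0" if "v = - v" for v :: "'g \<Rightarrow> real"
    using that by (simp add: fun_eq_iff)
  ultimately have "(\<Sum>a=1..4. \<Sum>b=1..4. F a b) = 0"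
    using sum.swap[of "\<lambda>a b. F b a" "{1..4}" "{1..4}"] by metis
  moreover have "endo_inner Q E T B = (\<Sum>a=1..4. \<Sum>b=1..4. F a b)"
    unfolding endo_inner_def F_def by (intro sum.cong refl parseval T B hor)
  ultimately show ?thesis by simp
qed

end

section \<open>Existence of the Biquard connection\<close>

context g2_coframe
begin

text \<open>The entries \<open>A\<^sub>j\<^sub>k\<close> of the skew matrix of connection 1-forms of the Biquard connection. On \<open>H\<close> the
  values on horizontal arguments come from the Koszul formula for the horizontal parts of the brackets, and
  those on \<open>\<xi> \<in> V\<close> are the skew part of \<open>X \<mapsto> [\<xi>, X]\<close> on \<open>H\<close>, the choice for which the torsion
  endomorphism becomes symmetric. The block on \<open>V\<close> is then forced by \<open>\<nabla>\<phi> = 0\<close>: the 1-forms act on the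
  \<open>\<xi>\<^sub>r\<close> as the self-dual part of the first block acts on the \<open>I\<^sub>r\<close>, so that \<open>A\<^sub>5\<^sub>6 = A\<^sub>1\<^sub>4 + A\<^sub>2\<^sub>3\<close>,
  \<open>A\<^sub>5\<^sub>7 = - A\<^sub>1\<^sub>3 + A\<^sub>2\<^sub>4\<close> and \<open>A\<^sub>6\<^sub>7 = A\<^sub>1\<^sub>2 + A\<^sub>3\<^sub>4\<close>.\<close>

definition conn12 where "conn12 Z = (\<lambda>_. 2/3) * \<theta> 2 [Z] + (\<lambda>_. 1/12) * \<theta> 5 [Z]"
definition conn34 where "conn34 Z = (\<lambda>_. - 2/3) * \<theta> 2 [Z] + (\<lambda>_. 1/12) * \<theta> 5 [Z]"
definition conn13 where "conn13 Z = (\<lambda>_. - 2/3) * \<theta> 3 [Z] + (\<lambda>_. 1/12) * \<theta> 6 [Z]"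
definition conn24 where "conn24 Z = (\<lambda>_. - 2/3) * \<theta> 3 [Z] - (\<lambda>_. 1/12) * \<theta> 6 [Z]"
definition conn14 where "conn14 Z = (\<lambda>_. - 2/3) * \<theta> 4 [Z]"
definition conn23 where "conn23 Z = (\<lambda>_. - 1/3) * \<theta> 4 [Z]"
definition conn56 where "conn56 Z = - \<theta> 4 [Z]"
definition conn57 where "conn57 Z = (\<lambda>_. - 1/6) * \<theta> 6 [Z]"
definition conn67 where "conn67 Z = (\<lambda>_. 1/6) * \<theta> 5 [Z]"

lemmas conn_defs = conn12_def conn34_def conn13_def conn24_def conn14_def conn23_def
  conn56_def conn57_def conn67_def

lemma conn_smooth:
  assumes "Z \<in> vector_fields A"
  shows "conn12 Z \<in> smooth_funs A" "conn34 Z \<in> smooth_funs A" "conn13 Z \<in> smooth_funs A"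
    "conn24 Z \<in> smooth_funs A" "conn14 Z \<in> smooth_funs A" "conn23 Z \<in> smooth_funs A"
    "conn56 Z \<in> smooth_funs A" "conn57 Z \<in> smooth_funs A" "conn67 Z \<in> smooth_funs A"
  unfolding conn_defs using assms by (simp_all add: smooth_intros)

definition bconn :: "'g vfield \<Rightarrow> 'g vfield \<Rightarrow> 'g vfield" where
  "bconn Z X =
    (Z (\<theta> 1 [X]) - conn12 Z * \<theta> 2 [X] - conn13 Z * \<theta> 3 [X] - conn14 Z * \<theta> 4 [X]) \<odot> e 1
  + (Z (\<theta> 2 [X]) + conn12 Z * \<theta> 1 [X] - conn23 Z * \<theta> 3 [X] - conn24 Z * \<theta> 4 [X]) \<odot> e 2
  + (Z (\<theta> 3 [X]) + conn13 Z * \<theta> 1 [X] + conn23 Z * \<theta> 2 [X] - conn34 Z * \<theta> 4 [X]) \<odot> e 3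
  + (Z (\<theta> 4 [X]) + conn14 Z * \<theta> 1 [X] + conn24 Z * \<theta> 2 [X] + conn34 Z * \<theta> 3 [X]) \<odot> e 4
  + (Z (\<theta> 5 [X]) - conn56 Z * \<theta> 6 [X] - conn57 Z * \<theta> 7 [X]) \<odot> e 5
  + (Z (\<theta> 6 [X]) + conn56 Z * \<theta> 5 [X] - conn67 Z * \<theta> 7 [X]) \<odot> e 6
  + (Z (\<theta> 7 [X]) + conn57 Z * \<theta> 5 [X] + conn67 Z * \<theta> 6 [X]) \<odot> e 7"

lemma bconn_vf: "Z \<in> vector_fields A \<Longrightarrow> X \<in> vector_fields A \<Longrightarrow> bconn Z X \<in> vector_fields A"
  by (simp add: bconn_def vf_intros smooth_intros conn_smooth)

lemma bconn_comps:
  assumes "Z \<in> vector_fields A" "X \<in> vector_fields A"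
  shows
    "\<theta> 1 [bconn Z X] = Z (\<theta> 1 [X]) - conn12 Z * \<theta> 2 [X] - conn13 Z * \<theta> 3 [X] - conn14 Z * \<theta> 4 [X]"
    "\<theta> 2 [bconn Z X] = Z (\<theta> 2 [X]) + conn12 Z * \<theta> 1 [X] - conn23 Z * \<theta> 3 [X] - conn24 Z * \<theta> 4 [X]"
    "\<theta> 3 [bconn Z X] = Z (\<theta> 3 [X]) + conn13 Z * \<theta> 1 [X] + conn23 Z * \<theta> 2 [X] - conn34 Z * \<theta> 4 [X]"
    "\<theta> 4 [bconn Z X] = Z (\<theta> 4 [X]) + conn14 Z * \<theta> 1 [X] + conn24 Z * \<theta> 2 [X] + conn34 Z * \<theta> 3 [X]"
    "\<theta> 5 [bconn Z X] = Z (\<theta> 5 [X]) - conn56 Z * \<theta> 6 [X] - conn57 Z * \<theta> 7 [X]"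
    "\<theta> 6 [bconn Z X] = Z (\<theta> 6 [X]) + conn56 Z * \<theta> 5 [X] - conn67 Z * \<theta> 7 [X]"
    "\<theta> 7 [bconn Z X] = Z (\<theta> 7 [X]) + conn57 Z * \<theta> 5 [X] + conn67 Z * \<theta> 6 [X]"
  using assms unfolding bconn_def
  by (simp_all add: vf_intros smooth_intros conn_smooth comp_simps)

lemma bconn_linear_connection: "linear_connection A bconn"
proof -
  note s = bconn_vf bconn_comps vf_intros smooth_intros comp_simps derivation conn_defs
  have comps: "X = Y" if "X \<in> vector_fields A" "Y \<in> vector_fields A"
      "\<forall>i\<in>{1..7}. \<theta> i [X] = \<theta> i [Y]" for X Y
    using that vf_eqI by blast
  show ?thesis
    unfolding linear_connection_def
  proof (intro ballI conjI)
    fix X Y assume X: "X \<in> vector_fields A" and Y: "Y \<in> vector_fields A"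
    show "bconn X Y \<in> vector_fields A" using X Y by (rule bconn_vf)
    {
      fix Z assume Z: "Z \<in> vector_fields A"
      show "bconn (X + Z) Y = bconn X Y + bconn Z Y"
        by (rule comps) (simp_all add: X Y Z s, simp add: X Y Z s ball_1_7 fun_eq_iff algebra_simps)
      show "bconn X (Y + Z) = bconn X Y + bconn X Z"
        by (rule comps) (simp_all add: X Y Z s, simp add: X Y Z s ball_1_7 fun_eq_iff algebra_simps)
    }
    {
      fix u assume u: "u \<in> smooth_funs A"
      show "bconn (u \<odot> X) Y = u \<odot> bconn X Y"
        by (rule comps) (simp_all add: X Y u s, simp add: X Y u s ball_1_7 fscale_apply fun_eq_iff algebra_simps)
      show "bconn X (u \<odot> Y) = X u \<odot> Y + u \<odot> bconn X Y"
        by (rule comps) (simp_all add: X Y u s, simp add: X Y u s ball_1_7 fun_eq_iff algebra_simps)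
    }
  qed
qed

lemma bconn_hor: "Z \<in> vector_fields A \<Longrightarrow> X \<in> hor Q \<Longrightarrow> bconn Z X \<in> hor Q"
  by (simp add: hor_iff bconn_vf bconn_comps derivation) (simp add: fun_eq_iff)

lemma bconn_vert: "Z \<in> vector_fields A \<Longrightarrow> X \<in> vert A Q \<Longrightarrow> bconn Z X \<in> vert A Q"
  by (simp add: vert_iff bconn_vf bconn_comps derivation) (simp add: fun_eq_iff)

lemma bconn_metric:
  assumes "Z \<in> vector_fields A" "X \<in> vector_fields A" "Y \<in> vector_fields A"
  shows "Z (ext_met Q X Y) = ext_met Q (bconn Z X) Y + ext_met Q X (bconn Z Y)"
  using assms
  by (simp add: ext_met_eq bconn_vf bconn_comps derivation smooth_intros) (simp add: fun_eq_iff algebra_simps)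

lemma bconn_phi:
  assumes "Z \<in> vector_fields A" "\<xi> \<in> vector_fields A" "X \<in> hor Q"
  shows "bconn Z (phi Q \<xi> X) - phi Q \<xi> (bconn Z X) = phi Q (bconn Z \<xi>) X"
proof -
  have X: "X \<in> vector_fields A" using assms(3) by (rule hor_vf)
  show ?thesis
    by (rule hor_eqI)
       (simp_all add: hor_intros assms X bconn_hor phi_hor bconn_vf bconn_comps phi_comps comp_simps hor_vf
          derivation smooth_intros conn_defs fun_eq_iff algebra_simps)
qed

lemma bconn_torsion_hor:
  assumes "X \<in> hor Q" "Y \<in> hor Q"
  shows "torsion bconn X Y = - vproj Q (lie_bracket X Y)"
proof -
  have X: "X \<in> vector_fields A" and Y: "Y \<in> vector_fields A" using assms hor_vf by auto
  show ?thesis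
    unfolding torsion_def
    by (rule vf_eqI)
       (auto simp: atLeastAtMost_1_7 X Y vf_intros bconn_vf bconn_comps vproj_vf vproj_comps comp_simps
          fun_eq_iff structure_equations hor_comps[OF assms(1)] hor_comps[OF assms(2)] derivation
          conn_defs field_simps)
qed

text \<open>The coefficients form a symmetric matrix with respect to \<open>e\<^sub>1, \<dots>, e\<^sub>4\<close>, as the trace condition
  demands, and they do not all vanish, which is the non-zero torsion.\<close>

lemma bconn_torsion_vert:
  assumes \<xi>: "\<xi> \<in> vert A Q" and X: "X \<in> hor Q"
  shows "torsion bconn \<xi> X \<in> hor Q"
    "\<theta> 1 [torsion bconn \<xi> X] p = - 1/12 * (\<theta> 5 [\<xi>] p * \<theta> 2 [X] p + \<theta> 6 [\<xi>] p * \<theta> 3 [X] p)"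
    "\<theta> 2 [torsion bconn \<xi> X] p = - 1/12 * (\<theta> 5 [\<xi>] p * \<theta> 1 [X] p + \<theta> 6 [\<xi>] p * \<theta> 4 [X] p)"
    "\<theta> 3 [torsion bconn \<xi> X] p = 1/12 * (\<theta> 5 [\<xi>] p * \<theta> 4 [X] p - \<theta> 6 [\<xi>] p * \<theta> 1 [X] p)"
    "\<theta> 4 [torsion bconn \<xi> X] p = 1/12 * (\<theta> 5 [\<xi>] p * \<theta> 3 [X] p - \<theta> 6 [\<xi>] p * \<theta> 2 [X] p)"
proof -
  have X': "X \<in> vector_fields A" and \<xi>': "\<xi> \<in> vector_fields A" using X \<xi> hor_vf vert_vf by auto
  note s = X' \<xi>' vf_intros bconn_vf bconn_comps comp_simps structure_equations
     hor_comps[OF X] vert_comps[OF \<xi>] derivation conn_defs field_simps fun_eq_iff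
  show "torsion bconn \<xi> X \<in> hor Q"
    unfolding hor_iff torsion_def by (simp add: s)
  show
    "\<theta> 1 [torsion bconn \<xi> X] p = - 1/12 * (\<theta> 5 [\<xi>] p * \<theta> 2 [X] p + \<theta> 6 [\<xi>] p * \<theta> 3 [X] p)"
    "\<theta> 2 [torsion bconn \<xi> X] p = - 1/12 * (\<theta> 5 [\<xi>] p * \<theta> 1 [X] p + \<theta> 6 [\<xi>] p * \<theta> 4 [X] p)"
    "\<theta> 3 [torsion bconn \<xi> X] p = 1/12 * (\<theta> 5 [\<xi>] p * \<theta> 4 [X] p - \<theta> 6 [\<xi>] p * \<theta> 1 [X] p)"
    "\<theta> 4 [torsion bconn \<xi> X] p = 1/12 * (\<theta> 5 [\<xi>] p * \<theta> 3 [X] p - \<theta> 6 [\<xi>] p * \<theta> 2 [X] p)"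
    unfolding torsion_def by (simp_all add: s)
qed

theorem bconn_biquard: "biquard_connection A Q bconn"
  unfolding biquard_connection_def
proof (intro conjI ballI allI impI)
  show "linear_connection A bconn" by (rule bconn_linear_connection)
next
  fix Z X assume "Z \<in> vector_fields A" "X \<in> hor Q"
  then show "bconn Z X \<in> hor Q" by (rule bconn_hor)
next
  fix Z X assume "Z \<in> vector_fields A" "X \<in> vert A Q"
  then show "bconn Z X \<in> vert A Q" by (rule bconn_vert)
next
  fix Z X Y assume "Z \<in> vector_fields A" "X \<in> vector_fields A" "Y \<in> vector_fields A"
  then show "Z (ext_met Q X Y) = ext_met Q (bconn Z X) Y + ext_met Q X (bconn Z Y)"
    by (rule bconn_metric)
next
  fix X Y assume "X \<in> hor Q" "Y \<in> hor Q"
  then show "torsion bconn X Y = - vproj Q (lie_bracket X Y)" by (rule bconn_torsion_hor)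
next
  fix Z \<xi> X assume "Z \<in> vector_fields A" "\<xi> \<in> vert A Q" "X \<in> hor Q"
  then show "endo_deriv bconn Z (phi Q \<xi>) X = phi Q (bconn Z \<xi>) X"
    unfolding endo_deriv_def by (simp add: bconn_phi vert_vf)
next
  fix \<xi> X assume "\<xi> \<in> vert A Q" "X \<in> hor Q"
  then show "torsion bconn \<xi> X \<in> hor Q" by (rule bconn_torsion_vert)
next
  fix \<xi> B E assume \<xi>: "\<xi> \<in> vert A Q" and *: "(quaternionic_section A Q B \<or> commuting_skew_endo A Q B) \<and> hor_orthonormal_frame Q E"
  have B: "(\<forall>X\<in>hor Q. B X \<in> hor Q) \<and> (\<forall>X\<in>hor Q. \<forall>Y\<in>hor Q. met Q (B X) Y = - met Q X (B Y))"
  proof (cases "commuting_skew_endo A Q B")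
    case True
    then show ?thesis by (simp add: commuting_skew_endo_def hor_endo_def)
  next
    case False
    with * obtain u where u: "\<forall>r\<in>{1..3}. u r \<in> smooth_funs A"
      and B: "\<forall>X\<in>hor Q. B X = (\<Sum>r=1..3. u r \<odot> acs Q r X)"
      unfolding quaternionic_section_def by blast
    show ?thesis using u unfolding ball_1_3
      by (simp add: B sum_1_3 hor_intros acs_hor hor_vf)
         (simp add: met_eq comp_simps vf_intros acs_vf acs_comps hor_vf algebra_simps)
  qed
  show "endo_inner Q E (torsion bconn \<xi>) B = 0"
  proof (rule endo_inner_symmetric_skew)
    show "hor_orthonormal_frame Q E" using * by blast
    show "torsion bconn \<xi> X \<in> hor Q" if "X \<in> hor Q" for X using \<xi> that by (rule bconn_torsion_vert)
    show "met Q (torsion bconn \<xi> X) Y = met Q X (torsion bconn \<xi> Y)"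
      if "X \<in> hor Q" "Y \<in> hor Q" for X Y
      by (simp add: fun_eq_iff met_eq bconn_torsion_vert[OF \<xi>] that algebra_simps)
  qed (use B in auto)
next
  fix Z B assume Z: "Z \<in> vector_fields A" and "quaternionic_section A Q B"
  then obtain u where u: "u 1 \<in> smooth_funs A" "u 2 \<in> smooth_funs A" "u 3 \<in> smooth_funs A"
    and B: "\<And>X. X \<in> hor Q \<Longrightarrow> B X = (\<Sum>r=1..3. u r \<odot> acs Q r X)"
    unfolding quaternionic_section_def ball_1_3 by blast
  \<comment> \<open>On \<open>H\<close> the section \<open>B\<close> is the image under \<open>\<phi>\<close> of a vertical field, so \<open>\<nabla>\<phi> = 0\<close> applies.\<close>
  define \<xi> where "\<xi> = u 1 \<odot> e 5 + u 2 \<odot> e 6 + u 3 \<odot> e 7"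
  have \<xi>: "\<xi> \<in> vector_fields A" unfolding \<xi>_def using u by (simp add: vf_intros)
  have "B X = phi Q \<xi> X" if "X \<in> hor Q" for X
    using u by (simp add: B that phi_eq sum_1_3 \<xi>_def comp_simps vf_intros)
  then have "endo_deriv bconn Z B X = phi Q (bconn Z \<xi>) X" if "X \<in> hor Q" for X
    unfolding endo_deriv_def using that Z \<xi> by (simp add: bconn_hor bconn_phi)
  then have "\<forall>X\<in>hor Q. endo_deriv bconn Z B X = (\<Sum>r=1..3. \<theta> (4 + r) [bconn Z \<xi>] \<odot> acs Q r X)"
    by (simp add: phi_eq sum_1_3)
  moreover have "\<forall>r\<in>{1..3}. \<theta> (4 + r) [bconn Z \<xi>] \<in> smooth_funs A"
    using Z \<xi> by (simp add: ball_1_3 comp_smooth bconn_vf)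
  ultimately show "quaternionic_section A Q (endo_deriv bconn Z B)"
    unfolding quaternionic_section_def by (intro exI conjI)
qed

end

section \<open>Uniqueness of the Biquard connection on the horizontal bundle\<close>

context coframe7
begin

lemma connection_rules:
  assumes "linear_connection A D" "X \<in> vector_fields A" "Y \<in> vector_fields A"
  shows "D X Y \<in> vector_fields A"
    "Z \<in> vector_fields A \<Longrightarrow> D (X + Z) Y = D X Y + D Z Y"
    "Z \<in> vector_fields A \<Longrightarrow> D X (Y + Z) = D X Y + D X Z"
    "u \<in> smooth_funs A \<Longrightarrow> D (u \<odot> X) Y = u \<odot> D X Y"
    "u \<in> smooth_funs A \<Longrightarrow> D X (u \<odot> Y) = X u \<odot> Y + u \<odot> D X Y"
  using assms unfolding linear_connection_def by blast+

lemma biquard_rules: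
  assumes "biquard_connection A Q D"
  shows "linear_connection A D"
    "Z \<in> vector_fields A \<Longrightarrow> X \<in> hor Q \<Longrightarrow> D Z X \<in> hor Q"
    "Z \<in> vector_fields A \<Longrightarrow> X \<in> vert A Q \<Longrightarrow> D Z X \<in> vert A Q"
    "Z \<in> vector_fields A \<Longrightarrow> X \<in> vector_fields A \<Longrightarrow> Y \<in> vector_fields A \<Longrightarrow>
      Z (ext_met Q X Y) = ext_met Q (D Z X) Y + ext_met Q X (D Z Y)"
    "X \<in> hor Q \<Longrightarrow> Y \<in> hor Q \<Longrightarrow> torsion D X Y = - vproj Q (lie_bracket X Y)"
    "\<xi> \<in> vert A Q \<Longrightarrow> X \<in> hor Q \<Longrightarrow> torsion D \<xi> X \<in> hor Q"
    "\<xi> \<in> vert A Q \<Longrightarrow> quaternionic_section A Q B \<or> commuting_skew_endo A Q B \<Longrightarrow>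
      hor_orthonormal_frame Q E \<Longrightarrow> endo_inner Q E (torsion D \<xi>) B = 0"
  using assms unfolding biquard_connection_def by blast+

text \<open>The difference of two connections is tensorial, so it can be tested on the frame.\<close>

lemma connections_eq_on_hor:
  assumes D: "linear_connection A D" and D': "linear_connection A D'"
    and frame: "\<And>i a. i \<in> {1..7} \<Longrightarrow> a \<in> {1..4} \<Longrightarrow> D (e i) (e a) = D' (e i) (e a)"
    and Z: "Z \<in> vector_fields A" and X: "X \<in> hor Q"
  shows "D Z X = D' Z X"
proof -
  note rules = connection_rules[OF D] connection_rules[OF D']
  have 1: "D Z (e a) = D' Z (e a)" if a: "a \<in> {1..4}" for a
  proof -
    have ea: "e a \<in> vector_fields A" using a by (intro frame_vf) auto
    have "D (\<Sum>i=1..7. z i \<odot> e i) (e a) = D' (\<Sum>i=1..7. z i \<odot> e i) (e a)"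
      if "\<forall>i\<in>{1..7}. z i \<in> smooth_funs A" for z
      using that unfolding sum_1_7 ball_1_7
      by (simp add: rules ea vf_intros frame[OF _ a])
    from this[of "\<lambda>i. \<theta> i [Z]"] show ?thesis
      using Z comp_smooth expand[OF Z, symmetric] by simp
  qed
  have "D Z (\<Sum>a=1..4. x a \<odot> e a) = D' Z (\<Sum>a=1..4. x a \<odot> e a)"
    if "\<forall>a\<in>{1..4}. x a \<in> smooth_funs A" for x
    using that unfolding sum_1_4 ball_1_4
    by (simp add: rules Z vf_intros 1)
  moreover obtain x where "\<forall>a\<in>{1..4}. x a \<in> smooth_funs A" "X = (\<Sum>a=1..4. x a \<odot> e a)"
    using X by (auto simp: Q coframe_qc_def)
  ultimately show ?thesis by blast
qed

text \<open>The anti-self-dual counterparts of the \<open>I\<^sub>r\<close>; they span the second \<open>sp(1)\<close>.\<close>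

definition asd1 where
  "asd1 X = (- \<theta> 2 [X]) \<odot> e 1 + \<theta> 1 [X] \<odot> e 2 + \<theta> 4 [X] \<odot> e 3 + (- \<theta> 3 [X]) \<odot> e 4"
definition asd2 where
  "asd2 X = (- \<theta> 3 [X]) \<odot> e 1 + (- \<theta> 4 [X]) \<odot> e 2 + \<theta> 1 [X] \<odot> e 3 + \<theta> 2 [X] \<odot> e 4"
definition asd3 where
  "asd3 X = (- \<theta> 4 [X]) \<odot> e 1 + \<theta> 3 [X] \<odot> e 2 + (- \<theta> 2 [X]) \<odot> e 3 + \<theta> 1 [X] \<odot> e 4"

lemmas asd_defs = asd1_def asd2_def asd3_def

lemma asd_commuting_skew:
  "commuting_skew_endo A Q asd1" "commuting_skew_endo A Q asd2" "commuting_skew_endo A Q asd3"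
proof -
  have h: "asd1 X \<in> hor Q" "asd2 X \<in> hor Q" "asd3 X \<in> hor Q" if "X \<in> vector_fields A" for X
    using that by (simp_all add: hor_iff asd_defs vf_intros smooth_intros comp_simps)
  have c: "\<theta> 1 [asd1 X] = - \<theta> 2 [X]" "\<theta> 2 [asd1 X] = \<theta> 1 [X]" "\<theta> 3 [asd1 X] = \<theta> 4 [X]"
      "\<theta> 4 [asd1 X] = - \<theta> 3 [X]" "\<theta> 1 [asd2 X] = - \<theta> 3 [X]" "\<theta> 2 [asd2 X] = - \<theta> 4 [X]"
      "\<theta> 3 [asd2 X] = \<theta> 1 [X]" "\<theta> 4 [asd2 X] = \<theta> 2 [X]" "\<theta> 1 [asd3 X] = - \<theta> 4 [X]"
      "\<theta> 2 [asd3 X] = \<theta> 3 [X]" "\<theta> 3 [asd3 X] = - \<theta> 2 [X]" "\<theta> 4 [asd3 X] = \<theta> 1 [X]"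
    if "X \<in> vector_fields A" for X
    using that by (simp_all add: asd_defs vf_intros smooth_intros comp_simps)
  note s = h c hor_vf acs_hor acs_vf acs_comps vf_intros comp_simps hor_intros met_eq
  show "commuting_skew_endo A Q asd1" "commuting_skew_endo A Q asd2" "commuting_skew_endo A Q asd3"
    unfolding commuting_skew_endo_def hor_endo_def ball_1_3
    by (intro conjI ballI; (rule hor_eqI)?; simp add: s; simp add: fun_eq_iff algebra_simps)+
qed

lemma quaternionic_section_acs: "r \<in> {1..3} \<Longrightarrow> quaternionic_section A Q (acs Q r)"
  unfolding quaternionic_section_def
  by (intro exI[of _ "\<lambda>s. if s = r then 1 else 0"])
     (auto simp: smooth_one[OF atlas] smooth_zero[OF atlas] atLeastAtMost_1_3 sum_1_3 fscale_def fun_eq_iff)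

text \<open>The difference \<open>s\<close> of two Biquard connections is skew in its last two
  arguments because both are metric. On horizontal arguments it is also symmetric in the first two, since
  both have the same torsion there, and therefore vanishes. In a vertical direction it is the difference
  of the torsion endomorphisms, hence orthogonal to both copies of \<open>sp(1)\<close>; together these span all skew
  endomorphisms of \<open>H\<close>, to which \<open>s\<close> itself belongs.\<close>

theorem biquard_unique_on_hor:
  assumes D: "biquard_connection A Q D" and D': "biquard_connection A Q D'"
    and Z: "Z \<in> vector_fields A" and X: "X \<in> hor Q"
  shows "D Z X = D' Z X"
proof -
  have lin: "linear_connection A D" "linear_connection A D'"
    by (rule biquard_rules(1)[OF D], rule biquard_rules(1)[OF D'])
  note vf = connection_rules(1)[OF lin(1)] connection_rules(1)[OF lin(2)]
  note hor = biquard_rules(2)[OF D] biquard_rules(2)[OF D']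
  note vert = biquard_rules(3)[OF D] biquard_rules(3)[OF D']
  have e: "e i \<in> vector_fields A" if "i \<in> {1..7}" for i using that by (rule frame_vf)
  have eh: "e a \<in> hor Q" if "a \<in> {1..4}" for a using that by (rule frame_hor)
  have ev: "e i \<in> vert A Q" if "i \<in> {5..7}" for i
    using that by (simp add: vert_iff frame_vf dual)
  define s where "s i a b p = \<theta> b [D (e i) (e a)] p - \<theta> b [D' (e i) (e a)] p" for i a b p
  have skew: "s i a b p = - s i b a p" if i: "i \<in> {1..7}" and a: "a \<in> {1..4}" and b: "b \<in> {1..4}" for i a b p
  proof -
    have a': "e a \<in> vector_fields A" and b': "e b \<in> vector_fields A" using a b by (simp_all add: e)
    have "e i (ext_met Q (e a) (e b)) = ext_met Q (D (e i) (e a)) (e b) + ext_met Q (e a) (D (e i) (e b))"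
      "e i (ext_met Q (e a) (e b)) = ext_met Q (D' (e i) (e a)) (e b) + ext_met Q (e a) (D' (e i) (e b))"
      by (intro biquard_rules(4)[OF D] e[OF i] a' b', intro biquard_rules(4)[OF D'] e[OF i] a' b')
    then have *: "(ext_met Q (D (e i) (e a)) (e b) + ext_met Q (e a) (D (e i) (e b))) p =
        (ext_met Q (D' (e i) (e a)) (e b) + ext_met Q (e a) (D' (e i) (e b))) p" by simp
    have "ext_met Q Y (e a) p = \<theta> a [Y] p \<and> ext_met Q (e a) Y p = \<theta> a [Y] p"
      if "a \<in> {1..4}" "Y \<in> vector_fields A" for a Y
      using that unfolding atLeastAtMost_1_4 by (auto simp: ext_met_eq e dual)
    then show ?thesis
      using * a b vf[OF e[OF i] a'] vf[OF e[OF i] b'] by (simp add: s_def)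
  qed
  have hor_zero: "s i a b p = 0" if i: "i \<in> {1..4}" and a: "a \<in> {1..4}" and b: "b \<in> {1..4}" for i a b p
  proof -
    have sym: "s i a b p = s a i b p"
      if i: "i \<in> {1..4}" and a: "a \<in> {1..4}" and b: "b \<in> {1..4}" for i a b
    proof -
      have i': "e i \<in> vector_fields A" and a': "e a \<in> vector_fields A" using a i by (simp_all add: e)
      have "torsion D (e i) (e a) = torsion D' (e i) (e a)"
        by (simp only: biquard_rules(5)[OF D eh[OF i] eh[OF a]] biquard_rules(5)[OF D' eh[OF i] eh[OF a]])
      then have "D (e i) (e a) - D (e a) (e i) = D' (e i) (e a) - D' (e a) (e i)"
        by (simp add: torsion_def)
      then have "\<theta> b [D (e i) (e a) - D (e a) (e i)] p = \<theta> b [D' (e i) (e a) - D' (e a) (e i)] p"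
        by simp
      then show ?thesis using b vf i' a' by (simp add: s_def comp_diff)
    qed
    have i7: "i \<in> {1..7}" and a7: "a \<in> {1..7}" and b7: "b \<in> {1..7}" using i a b by auto
    \<comment> \<open>Alternating the two symmetries three times returns to the same entry with the opposite sign.\<close>
    show ?thesis
      using sym[OF i a b] skew[OF a7 i b, of p] sym[OF a b i] skew[OF b7 a i, of p]
        sym[OF b i a] skew[OF i7 b a, of p] by linarith
  qed
  have vert_zero: "s i a b p = 0" if i: "i \<in> {5..7}" and ab: "a \<in> {1..4}" "b \<in> {1..4}" for i a b p
  proof -
    have i': "e i \<in> vector_fields A" using i by (simp add: e)
    have Ts: "\<theta> b [torsion D (e i) (e a)] p - \<theta> b [torsion D' (e i) (e a)] p = s i a b p"
      if "a \<in> {1..4}" "b \<in> {1..4}" for a b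
    proof -
      have a': "e a \<in> vector_fields A" using that by (simp add: e)
      have "\<theta> b [D (e a) (e i)] = 0" "\<theta> b [D' (e a) (e i)] = 0"
        using vert[OF a' ev[OF i]] that(2) unfolding atLeastAtMost_1_4 by (auto simp: vert_iff)
      then show ?thesis
        using that by (simp add: torsion_def s_def comp_diff vf_intros vf i' a')
    qed
    have perp: "(\<Sum>a=1..4. met Q (torsion D (e i) (e a)) (B (e a)) p) = 0"
      "(\<Sum>a=1..4. met Q (torsion D' (e i) (e a)) (B (e a)) p) = 0"
      if "quaternionic_section A Q B \<or> commuting_skew_endo A Q B" for B
    proof -
      have "endo_inner Q e (torsion D (e i)) B = 0" "endo_inner Q e (torsion D' (e i)) B = 0"
        by (intro biquard_rules(7)[OF D ev[OF i] that] hor_orthonormal_frame,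
            intro biquard_rules(7)[OF D' ev[OF i] that] hor_orthonormal_frame)
      then show "(\<Sum>a=1..4. met Q (torsion D (e i) (e a)) (B (e a)) p) = 0"
        "(\<Sum>a=1..4. met Q (torsion D' (e i) (e a)) (B (e a)) p) = 0"
        by (simp_all add: endo_inner_def fun_eq_iff sum_fun_apply)
    qed
    have Bs: "(\<Sum>a=1..4. \<Sum>b=1..4. s i a b p * \<theta> b [B (e a)] p) = 0"
      if B: "quaternionic_section A Q B \<or> commuting_skew_endo A Q B" for B
    proof -
      have "s i a 1 p * \<theta> 1 [B (e a)] p + s i a 2 p * \<theta> 2 [B (e a)] p + s i a 3 p * \<theta> 3 [B (e a)] p
          + s i a 4 p * \<theta> 4 [B (e a)] p =
          met Q (torsion D (e i) (e a)) (B (e a)) p - met Q (torsion D' (e i) (e a)) (B (e a)) p"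
        if "a \<in> {1..4}" for a
        using Ts[OF that, of 1] Ts[OF that, of 2] Ts[OF that, of 3] Ts[OF that, of 4]
        by (simp add: met_eq algebra_simps flip: Ts)
      then have "(\<Sum>a=1..4. \<Sum>b=1..4. s i a b p * \<theta> b [B (e a)] p) =
          (\<Sum>a=1..4. met Q (torsion D (e i) (e a)) (B (e a)) p - met Q (torsion D' (e i) (e a)) (B (e a)) p)"
        by (intro sum.cong refl) (simp add: sum_1_4)
      also have "\<dots> = 0" using perp[OF B] by (simp add: sum_subtractf)
      finally show ?thesis .
    qed
    have sk: "s i 2 1 p = - s i 1 2 p" "s i 3 1 p = - s i 1 3 p" "s i 4 1 p = - s i 1 4 p"
      "s i 3 2 p = - s i 2 3 p" "s i 4 2 p = - s i 2 4 p" "s i 4 3 p = - s i 3 4 p"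
      "s i 1 1 p = 0" "s i 2 2 p = 0" "s i 3 3 p = 0" "s i 4 4 p = 0"
      using skew[of i 2 1 p] skew[of i 3 1 p] skew[of i 4 1 p] skew[of i 3 2 p] skew[of i 4 2 p]
        skew[of i 4 3 p] skew[of i 1 1 p] skew[of i 2 2 p] skew[of i 3 3 p] skew[of i 4 4 p] i by auto
    note simps = sum_1_4 acs_comps e dual asd_defs comp_simps vf_intros smooth_intros sk
    have "s i 1 2 p + s i 3 4 p = 0" "s i 1 3 p - s i 2 4 p = 0" "s i 1 4 p + s i 2 3 p = 0"
      using Bs[OF disjI1[OF quaternionic_section_acs[of 1]]] Bs[OF disjI1[OF quaternionic_section_acs[of 2]]]
        Bs[OF disjI1[OF quaternionic_section_acs[of 3]]]
      by (simp_all add: simps)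
    moreover have "s i 1 2 p - s i 3 4 p = 0" "s i 1 3 p + s i 2 4 p = 0" "s i 1 4 p - s i 2 3 p = 0"
      using Bs[OF disjI2[OF asd_commuting_skew(1)]] Bs[OF disjI2[OF asd_commuting_skew(2)]]
        Bs[OF disjI2[OF asd_commuting_skew(3)]]
      by (simp_all add: simps)
    ultimately show ?thesis using ab sk unfolding atLeastAtMost_1_4 by auto
  qed
  have "D (e i) (e a) = D' (e i) (e a)" if i: "i \<in> {1..7}" and a: "a \<in> {1..4}" for i a
  proof -
    have z: "s i a b p = 0" if "b \<in> {1..4}" for b p
      using hor_zero[of i a b p] vert_zero[of i a b p] i a that by (cases "i \<le> 4") auto
    have "\<theta> b [D (e i) (e a)] = \<theta> b [D' (e i) (e a)]" if "b \<in> {1..4}" for b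
      using z[OF that] by (simp add: s_def fun_eq_iff)
    then show ?thesis by (intro hor_eqI hor e i eh a) simp_all
  qed
  then show ?thesis using connections_eq_on_hor[OF lin _ Z X] by blast
qed

lemma biquard_curvature_unique_on_hor:
  assumes D: "biquard_connection A Q D" and D': "biquard_connection A Q D'"
    and hor: "X \<in> vector_fields A" "Y \<in> vector_fields A" "Z \<in> hor Q"
  shows "curvature D X Y Z = curvature D' X Y Z"
proof -
  have "D' W Z \<in> hor Q" if "W \<in> vector_fields A" for W
    using biquard_rules(2)[OF D'] that hor by blast
  then show ?thesis
    using hor by (simp add: curvature_def biquard_unique_on_hor[OF D D'] vf_intros)
qed

end

section \<open>Torsion and curvature\<close>

text \<open>For an orthogonal matrix the induced action on bivectors is orthogonal as well. The factor 2
  arises because both orders of each pair of vectors occur in the sum.\<close>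

lemma plucker_trace:
  fixes m :: "nat \<Rightarrow> nat \<Rightarrow> real"
  assumes orth: "\<And>i j. i \<in> {1..4} \<Longrightarrow> j \<in> {1..4} \<Longrightarrow> (\<Sum>a=1..4. m a i * m a j) = (if i = j then 1 else 0)"
    and ij: "i \<in> {1..4}" "j \<in> {1..4}" "k \<in> {1..4}" "l \<in> {1..4}"
  shows "(\<Sum>a=1..4. \<Sum>b=1..4. (m b i * m a j - m b j * m a i) * (m b k * m a l - m b l * m a k)) =
    2 * ((if i = k then 1 else 0) * (if j = l then 1 else 0) - (if i = l then 1 else 0) * (if j = k then 1 else 0))"
proof -
  have "(\<Sum>a=1..4. \<Sum>b=1..4. (m b i * m a j - m b j * m a i) * (m b k * m a l - m b l * m a k)) =
    2 * ((\<Sum>a=1..4. m a i * m a k) * (\<Sum>a=1..4. m a j * m a l)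
       - (\<Sum>a=1..4. m a i * m a l) * (\<Sum>a=1..4. m a j * m a k))"
    unfolding sum_1_4 by algebra
  then show ?thesis using orth ij by simp
qed

context g2_coframe
begin

lemma lie_bracket_apply: "lie_bracket X Y f = X (Y f) - Y (X f)"
  by (simp add: lie_bracket_def)

text \<open>The curvature in the form \<open>dA + A \<and> A\<close>. Derivatives of the components of the three fields cancel,
  and what is left is linear in the Pluecker coordinates \<open>w\<close> of \<open>X\<close> and \<open>Y\<close> and in the components of \<open>Z\<close>.
  The vertical part of \<open>[X, Y]\<close> enters through the values of the connection forms on \<open>V\<close>.\<close>

lemma bconn_curvature:
  assumes X: "X \<in> hor Q" and Y: "Y \<in> hor Q" and Z: "Z \<in> hor Q"
  defines "w \<equiv> \<lambda>i j p. \<theta> i [X] p * \<theta> j [Y] p - \<theta> j [X] p * \<theta> i [Y] p"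
  shows
    "\<theta> 1 [curvature bconn X Y Z] p = - (11/18 * w 1 2 p - 5/18 * w 3 4 p) * \<theta> 2 [Z] p
      - (11/18 * w 1 3 p + 5/18 * w 2 4 p) * \<theta> 3 [Z] p - (4/9 * w 1 4 p + 8/9 * w 2 3 p) * \<theta> 4 [Z] p"
    "\<theta> 2 [curvature bconn X Y Z] p = (11/18 * w 1 2 p - 5/18 * w 3 4 p) * \<theta> 1 [Z] p
      - (2/9 * w 1 4 p - 8/9 * w 2 3 p) * \<theta> 3 [Z] p - (5/18 * w 1 3 p + 11/18 * w 2 4 p) * \<theta> 4 [Z] p"
    "\<theta> 3 [curvature bconn X Y Z] p = (11/18 * w 1 3 p + 5/18 * w 2 4 p) * \<theta> 1 [Z] p
      + (2/9 * w 1 4 p - 8/9 * w 2 3 p) * \<theta> 2 [Z] p - (11/18 * w 3 4 p - 5/18 * w 1 2 p) * \<theta> 4 [Z] p"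
    "\<theta> 4 [curvature bconn X Y Z] p = (4/9 * w 1 4 p + 8/9 * w 2 3 p) * \<theta> 1 [Z] p
      + (5/18 * w 1 3 p + 11/18 * w 2 4 p) * \<theta> 2 [Z] p + (11/18 * w 3 4 p - 5/18 * w 1 2 p) * \<theta> 3 [Z] p"
proof -
  have v: "X \<in> vector_fields A" "Y \<in> vector_fields A" "Z \<in> vector_fields A"
    using X Y Z hor_vf by auto
  note s = v vf_intros bconn_vf bconn_comps comp_simps structure_equations smooth_intros conn_smooth
     hor_comps[OF X] hor_comps[OF Y] hor_comps[OF Z] derivation conn_defs lie_bracket_apply
  show
    "\<theta> 1 [curvature bconn X Y Z] p = - (11/18 * w 1 2 p - 5/18 * w 3 4 p) * \<theta> 2 [Z] p
      - (11/18 * w 1 3 p + 5/18 * w 2 4 p) * \<theta> 3 [Z] p - (4/9 * w 1 4 p + 8/9 * w 2 3 p) * \<theta> 4 [Z] p"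
    unfolding curvature_def w_def by (simp add: s) (simp add: field_simps)
  show
    "\<theta> 2 [curvature bconn X Y Z] p = (11/18 * w 1 2 p - 5/18 * w 3 4 p) * \<theta> 1 [Z] p
      - (2/9 * w 1 4 p - 8/9 * w 2 3 p) * \<theta> 3 [Z] p - (5/18 * w 1 3 p + 11/18 * w 2 4 p) * \<theta> 4 [Z] p"
    unfolding curvature_def w_def by (simp add: s) (simp add: field_simps)
  show
    "\<theta> 3 [curvature bconn X Y Z] p = (11/18 * w 1 3 p + 5/18 * w 2 4 p) * \<theta> 1 [Z] p
      + (2/9 * w 1 4 p - 8/9 * w 2 3 p) * \<theta> 2 [Z] p - (11/18 * w 3 4 p - 5/18 * w 1 2 p) * \<theta> 4 [Z] p"
    unfolding curvature_def w_def by (simp add: s) (simp add: field_simps)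
  show
    "\<theta> 4 [curvature bconn X Y Z] p = (4/9 * w 1 4 p + 8/9 * w 2 3 p) * \<theta> 1 [Z] p
      + (5/18 * w 1 3 p + 11/18 * w 2 4 p) * \<theta> 2 [Z] p + (11/18 * w 3 4 p - 5/18 * w 1 2 p) * \<theta> 3 [Z] p"
    unfolding curvature_def w_def by (simp add: s) (simp add: field_simps)
qed

lemma bconn_curvature_hor:
  "X \<in> hor Q \<Longrightarrow> Y \<in> hor Q \<Longrightarrow> Z \<in> hor Q \<Longrightarrow> curvature bconn X Y Z \<in> hor Q"
  unfolding curvature_def by (intro hor_intros bconn_hor vf_intros hor_vf)

text \<open>By the Pluecker relation \<open>w\<^sub>1\<^sub>2w\<^sub>3\<^sub>4 - w\<^sub>1\<^sub>3w\<^sub>2\<^sub>4 + w\<^sub>1\<^sub>4w\<^sub>2\<^sub>3 = 0\<close> only one mixed term remains.\<close>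

lemma bconn_sectional_curvature:
  assumes X: "X \<in> hor Q" and Y: "Y \<in> hor Q"
  defines "w \<equiv> \<lambda>i j p. \<theta> i [X] p * \<theta> j [Y] p - \<theta> j [X] p * \<theta> i [Y] p"
  shows "ext_met Q (curvature bconn X Y Y) X p =
    - (11/18 * (w 1 2 p * w 1 2 p + w 1 3 p * w 1 3 p + w 2 4 p * w 2 4 p + w 3 4 p * w 3 4 p)
       + 4/9 * (w 1 4 p * w 1 4 p) - 8/9 * (w 2 3 p * w 2 3 p) + 5/3 * (w 1 4 p * w 2 3 p))"
  using X Y unfolding w_def
  by (simp add: ext_met_eq hor_vf bconn_curvature_hor hor_comps bconn_curvature) algebra

text \<open>An arbitrary orthonormal frame of \<open>H\<close> is related to \<open>e\<^sub>1, \<dots>, e\<^sub>4\<close> by a pointwise orthogonal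
  matrix, so every square \<open>w\<^sub>i\<^sub>j\<^sup>2\<close> contributes 2 and the mixed term nothing. The sum of the sectional
  expressions is thus \<open>- 2 (4 \<cdot> 11/18 + 4/9 - 8/9) = - 4 = 24 \<cdot> (- 1/6)\<close>.\<close>

theorem biquard_norm_qc_scal:
  assumes D: "biquard_connection A Q D" and E: "hor_orthonormal_frame Q E"
  shows "norm_qc_scal Q D E = (\<lambda>p. - 1/6)"
proof
  fix p
  have hor: "E a \<in> hor Q" if "a \<in> {1..4}" for a
    using E that by (simp add: hor_orthonormal_frame_def)
  define m where "m a i = \<theta> i [E a] p" for a i
  define w where "w a b i j = m b i * m a j - m b j * m a i" for a b i j
  have orth: "(\<Sum>a=1..4. m a i * m a j) = (if i = j then 1 else 0)"
    if i: "i \<in> {1..4}" and j: "j \<in> {1..4}" for i j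
  proof -
    have met_e: "met Q (e i) X p = \<theta> i [X] p" for X
      using i unfolding atLeastAtMost_1_4 by (auto simp: met_eq dual)
    have ei: "e i = (\<Sum>a=1..4. met Q (e i) (E a) \<odot> E a)"
      using E frame_hor[OF i] unfolding hor_orthonormal_frame_def by blast
    have sm: "met Q (e i) (E a) \<in> smooth_funs A" if "a \<in> {1..4}" for a
      using hor_metric frame_hor[OF i] hor[OF that] unfolding hor_metric_def by blast
    have "\<theta> j [\<Sum>a=1..4. met Q (e i) (E a) \<odot> E a] = (\<Sum>a=1..4. \<theta> j [met Q (e i) (E a) \<odot> E a])"
      using j by (intro one_form_sum[OF atlas coframe_form] vf_intros sm hor_vf hor) auto
    also have "\<dots> = (\<Sum>a=1..4. met Q (e i) (E a) * \<theta> j [E a])"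
      using j by (intro sum.cong refl comp_scale sm hor_vf hor) auto
    finally have "\<theta> j [e i] p = (\<Sum>a=1..4. m a i * m a j)"
      unfolding ei[symmetric] by (simp add: sum_fun_apply met_e m_def)
    moreover have "\<theta> j [e i] = (if i = j then 1 else 0)"
      using i j by (simp add: dual)
    ultimately show ?thesis by (cases "i = j") simp_all
  qed
  have curv: "ext_met Q (curvature D (E b) (E a) (E a)) (E b) p =
    - (11/18 * (w a b 1 2 * w a b 1 2 + w a b 1 3 * w a b 1 3 + w a b 2 4 * w a b 2 4 + w a b 3 4 * w a b 3 4)
       + 4/9 * (w a b 1 4 * w a b 1 4) - 8/9 * (w a b 2 3 * w a b 2 3) + 5/3 * (w a b 1 4 * w a b 2 3))"
    if a: "a \<in> {1..4}" and b: "b \<in> {1..4}" for a b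
  proof -
    have "curvature D (E b) (E a) (E a) = curvature bconn (E b) (E a) (E a)"
      by (intro biquard_curvature_unique_on_hor[OF D bconn_biquard] hor_vf hor a b)
    then show ?thesis
      by (simp only: bconn_sectional_curvature[OF hor[OF b] hor[OF a]] w_def m_def)
  qed
  define P where "P i j k l = (\<Sum>a=1..4. \<Sum>b=1..4. w a b i j * w a b k l)" for i j k l
  have P: "P i j k l = 2 * ((if i = k then 1 else 0) * (if j = l then 1 else 0)
      - (if i = l then 1 else 0) * (if j = k then 1 else 0))"
    if "i \<in> {1..4}" "j \<in> {1..4}" "k \<in> {1..4}" "l \<in> {1..4}" for i j k l
    unfolding P_def w_def by (rule plucker_trace[OF orth that])
  have "(\<Sum>a=1..4. \<Sum>b=1..4. ext_met Q (curvature D (E b) (E a) (E a)) (E b) p) =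
    (\<Sum>a=1..4. \<Sum>b=1..4.
       (-11/18) * (w a b 1 2 * w a b 1 2) + (-11/18) * (w a b 1 3 * w a b 1 3)
     + (-11/18) * (w a b 2 4 * w a b 2 4) + (-11/18) * (w a b 3 4 * w a b 3 4)
     + (-4/9) * (w a b 1 4 * w a b 1 4) + 8/9 * (w a b 2 3 * w a b 2 3)
     + (-5/3) * (w a b 1 4 * w a b 2 3))"
    by (intro sum.cong refl) (simp add: curv algebra_simps)
  also have "\<dots> = (-11/18) * P 1 2 1 2 + (-11/18) * P 1 3 1 3 + (-11/18) * P 2 4 2 4
     + (-11/18) * P 3 4 3 4 + (-4/9) * P 1 4 1 4 + 8/9 * P 2 3 2 3 + (-5/3) * P 1 4 2 3"
    by (simp only: sum.distrib sum_distrib_left[symmetric] P_def)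
  also have "\<dots> = - 4" by (simp add: P)
  finally show "norm_qc_scal Q D E p = - 1/6" by (simp add: norm_qc_scal_def)
qed

theorem biquard_nonzero_torsion:
  assumes D: "biquard_connection A Q D"
  shows "nonzero_torsion_endo A Q D"
proof -
  have e: "e 5 \<in> vert A Q" "e 1 \<in> hor Q" "e 1 \<in> vector_fields A" "e 5 \<in> vector_fields A"
    by (simp_all add: vert_iff frame_hor frame_vf dual)
  have lin: "linear_connection A D" and vert: "D (e 1) (e 5) \<in> vert A Q"
    using biquard_rules(1,3)[OF D] e by blast+
  \<comment> \<open>Agreement is known for horizontal fields only, but \<open>\<nabla>\<^sub>e\<^sub>1 e\<^sub>5\<close> is vertical for both.\<close>
  have "\<theta> 2 [torsion D (e 5) (e 1)] p = \<theta> 2 [torsion bconn (e 5) (e 1)] p" for p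
    using e vert bconn_vert[OF e(3,1)] connection_rules(1)[OF lin]
    by (simp add: torsion_def biquard_unique_on_hor[OF D bconn_biquard] comp_diff vf_intros bconn_vf vert_comps)
  also have "\<theta> 2 [torsion bconn (e 5) (e 1)] p = - 1/12" for p
    by (simp add: bconn_torsion_vert[OF e(1,2)] dual)
  finally have "\<theta> 2 [torsion D (e 5) (e 1)] \<noteq> 0" by (simp add: fun_eq_iff)
  then have "torsion D (e 5) (e 1) \<noteq> 0" using comp_zero[of 2] by auto
  then show ?thesis unfolding nonzero_torsion_endo_def using e by blast
qed

end

section \<open>The fundamental 4-form\<close>

text \<open>The 24 permutations contribute eight times to each of the three ways to split four arguments into
  two pairs.\<close>

lemma wedge_2_2:
  assumes "\<And>U V. U \<in> {W, X, Y, Z} \<Longrightarrow> V \<in> {W, X, Y, Z} \<Longrightarrow> \<alpha> [V, U] = - \<alpha> [U, V]"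
  shows "wedge 2 2 \<alpha> \<alpha> [W, X, Y, Z] p =
    2 * (\<alpha> [W, X] p * \<alpha> [Y, Z] p - \<alpha> [W, Y] p * \<alpha> [X, Z] p + \<alpha> [W, Z] p * \<alpha> [X, Y] p)"
proof -
  have eq: "{..<2 + 2::nat} = insert 0 (insert 1 (insert 2 (insert 3 {})))" by auto
  have upt: "[0..<2] = [0, 1::nat]" "[2..<2 + 2] = [2, 3::nat]" by (simp_all add: upt_rec)
  have sgn: "sign (Transposition.transpose a b \<circ> q) = (if a = b then 1 else -1) * sign q" if "permutation q" for a b :: nat and q
    using that by (simp add: sign_compose sign_swap_id permutation_swap_id)
  have perm: "permutation (Transposition.transpose a b \<circ> q)" if "permutation q" for a b :: nat and q
    using that by (simp add: permutation_compose permutation_swap_id)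
  have id: "{\<sigma>. \<forall>x::nat. \<sigma> x = x} = {id}" by (simp add: fun_eq_iff set_eq_iff)
  have anti: "\<alpha> [X, W] = - \<alpha> [W, X]" "\<alpha> [Y, W] = - \<alpha> [W, Y]" "\<alpha> [Z, W] = - \<alpha> [W, Z]"
    "\<alpha> [Y, X] = - \<alpha> [X, Y]" "\<alpha> [Z, X] = - \<alpha> [X, Z]" "\<alpha> [Z, Y] = - \<alpha> [Y, Z]"
    by (rule assms; blast)+
  show ?thesis
    unfolding wedge_def eq upt
    by (simp add: sum_over_permutations_insert id sgn perm permutation_swap_id sign_swap_id
        Transposition.transpose_def anti fact_numeral)
qed

text \<open>The determinant of the components 1 to 4 of four vectors, expanded along the first two vectors.
  The ring is left open so that the components can be functions or their values.\<close>

definition vol :: "(nat \<Rightarrow> 'r::comm_ring_1) \<Rightarrow> (nat \<Rightarrow> 'r) \<Rightarrow> (nat \<Rightarrow> 'r) \<Rightarrow> (nat \<Rightarrow> 'r) \<Rightarrow> 'r" where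
  "vol a b c d = (let w = (\<lambda>u v i j. u i * v j - u j * v i) in
     w a b 1 2 * w c d 3 4 - w a b 1 3 * w c d 2 4 + w a b 1 4 * w c d 2 3
   + w a b 2 3 * w c d 1 4 - w a b 2 4 * w c d 1 3 + w a b 3 4 * w c d 1 2)"

lemma vol_alternating: "vol a a c d = 0" "vol a b a d = 0" "vol a b c a = 0" "vol a b b d = 0"
    "vol a b c b = 0" "vol a b c c = 0"
  by (simp_all add: vol_def algebra_simps)

lemma vol_diff: "vol (\<lambda>i. a i - a' i) b c d = vol a b c d - vol a' b c d"
  by (simp add: vol_def algebra_simps)

lemma vol_add:
  "vol (\<lambda>i. a i + a' i) b c d = vol a b c d + vol a' b c d"
  "vol a (\<lambda>i. b i + b' i) c d = vol a b c d + vol a b' c d"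
  "vol a b (\<lambda>i. c i + c' i) d = vol a b c d + vol a b c' d"
  "vol a b c (\<lambda>i. d i + d' i) = vol a b c d + vol a b c d'"
  by (simp_all add: vol_def algebra_simps)

lemma vol_scale:
  "vol (\<lambda>i. u * a i) b c d = u * vol a b c d"
  "vol a (\<lambda>i. u * b i) c d = u * vol a b c d"
  "vol a b (\<lambda>i. u * c i) d = u * vol a b c d"
  "vol a b c (\<lambda>i. u * d i) = u * vol a b c d"
  by (simp_all add: vol_def algebra_simps)

lemma ext_d_4:
  "ext_d \<alpha> [V, W, X, Y, Z] =
     V (\<alpha> [W, X, Y, Z]) - W (\<alpha> [V, X, Y, Z]) + X (\<alpha> [V, W, Y, Z]) - Y (\<alpha> [V, W, X, Z]) + Z (\<alpha> [V, W, X, Y])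
   - \<alpha> [lie_bracket V W, X, Y, Z] + \<alpha> [lie_bracket V X, W, Y, Z] - \<alpha> [lie_bracket V Y, W, X, Z]
   + \<alpha> [lie_bracket V Z, W, X, Y] - \<alpha> [lie_bracket W X, V, Y, Z] + \<alpha> [lie_bracket W Y, V, X, Z]
   - \<alpha> [lie_bracket W Z, V, X, Y] - \<alpha> [lie_bracket X Y, V, W, Z] + \<alpha> [lie_bracket X Z, V, W, Y]
   - \<alpha> [lie_bracket Y Z, V, W, X]"
  by (simp add: ext_d_def omit_def lessThan_Suc)

lemma length_4: "length xs = 4 \<Longrightarrow> \<exists>a b c d. xs = [a, b, c, d]"
  by (simp add: length_Suc_conv eval_nat_numeral One_nat_def) blast

lemma vol_apply: "vol a b c d p = vol (\<lambda>i. a i p) (\<lambda>i. b i p) (\<lambda>i. c i p) (\<lambda>i. d i p)"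
  by (simp add: vol_def)

context coframe7
begin

lemma omega_eq:
  assumes "X \<in> vector_fields A" "Y \<in> vector_fields A"
  shows "omega Q 1 [X, Y] p = \<theta> 1 [X] p * \<theta> 2 [Y] p - \<theta> 2 [X] p * \<theta> 1 [Y] p
      + \<theta> 3 [X] p * \<theta> 4 [Y] p - \<theta> 4 [X] p * \<theta> 3 [Y] p"
    "omega Q 2 [X, Y] p = \<theta> 1 [X] p * \<theta> 3 [Y] p - \<theta> 3 [X] p * \<theta> 1 [Y] p
      + \<theta> 4 [X] p * \<theta> 2 [Y] p - \<theta> 2 [X] p * \<theta> 4 [Y] p"
    "omega Q 3 [X, Y] p = \<theta> 1 [X] p * \<theta> 4 [Y] p - \<theta> 4 [X] p * \<theta> 1 [Y] p
      + \<theta> 2 [X] p * \<theta> 3 [Y] p - \<theta> 3 [X] p * \<theta> 2 [Y] p"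
  using assms by (simp_all add: omega_def met_acs hproj_vf hproj_comps)

text \<open>Each \<open>\<omega>\<^sub>r \<and> \<omega>\<^sub>r\<close> is twice the volume form of \<open>H\<close>.\<close>

lemma fundamental_4form_eq:
  assumes "W \<in> vector_fields A" "X \<in> vector_fields A" "Y \<in> vector_fields A" "Z \<in> vector_fields A"
  shows "fundamental_4form Q [W, X, Y, Z] =
    (\<lambda>_. 6) * vol (\<lambda>i. \<theta> i [W]) (\<lambda>i. \<theta> i [X]) (\<lambda>i. \<theta> i [Y]) (\<lambda>i. \<theta> i [Z])"
proof
  fix p
  have "omega Q r [V, U] = - omega Q r [U, V]"
    if "r \<in> {1..3}" "U \<in> {W, X, Y, Z}" "V \<in> {W, X, Y, Z}" for r U V
  proof -
    have "U \<in> vector_fields A" "V \<in> vector_fields A" using that assms by auto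
    then show ?thesis using that(1) unfolding atLeastAtMost_1_3
      by (auto simp: fun_eq_iff omega_eq algebra_simps)
  qed
  then have w: "wedge 2 2 (omega Q r) (omega Q r) [W, X, Y, Z] p =
      2 * (omega Q r [W, X] p * omega Q r [Y, Z] p - omega Q r [W, Y] p * omega Q r [X, Z] p
         + omega Q r [W, Z] p * omega Q r [X, Y] p)" if "r \<in> {1..3}" for r
    using that by (intro wedge_2_2) blast
  show "fundamental_4form Q [W, X, Y, Z] p =
    ((\<lambda>_. 6) * vol (\<lambda>i. \<theta> i [W]) (\<lambda>i. \<theta> i [X]) (\<lambda>i. \<theta> i [Y]) (\<lambda>i. \<theta> i [Z])) p"
    using assms by (simp add: fundamental_4form_def sum_1_3 w omega_eq vol_apply) (simp add: vol_def algebra_simps)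
qed

lemma fundamental_4form_diff_form: "diff_form A 4 (fundamental_4form Q)"
  unfolding diff_form_def
proof (intro allI impI)
  fix Xs :: "'g vfield list" assume Xs: "length Xs = 4 \<and> set Xs \<subseteq> vector_fields A"
  then obtain W X Y Z where Xs_eq: "Xs = [W, X, Y, Z]"
    using length_4[of Xs] by blast
  have v: "W \<in> vector_fields A" "X \<in> vector_fields A" "Y \<in> vector_fields A" "Z \<in> vector_fields A"
    using Xs Xs_eq by auto
  have all4: "(\<forall>i<4::nat. P i) \<longleftrightarrow> P 0 \<and> P (Suc 0) \<and> P (Suc (Suc 0)) \<and> P (Suc (Suc (Suc 0)))" for P
    by (auto simp: eval_nat_numeral less_Suc_eq One_nat_def)
  have vol_cong: "vol a b c d = vol a' b' c' d'"
    if "\<And>i. i \<in> {1..4} \<Longrightarrow> a i = a' i \<and> b i = b' i \<and> c i = c' i \<and> d i = d' i"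
    for a b c d a' b' c' d' :: "nat \<Rightarrow> 'g \<Rightarrow> real"
    using that unfolding vol_def by simp
  have add: "vol (\<lambda>i. \<theta> i [U + U']) b c d = vol (\<lambda>i. \<theta> i [U]) b c d + vol (\<lambda>i. \<theta> i [U']) b c d"
    "vol a (\<lambda>i. \<theta> i [U + U']) c d = vol a (\<lambda>i. \<theta> i [U]) c d + vol a (\<lambda>i. \<theta> i [U']) c d"
    "vol a b (\<lambda>i. \<theta> i [U + U']) d = vol a b (\<lambda>i. \<theta> i [U]) d + vol a b (\<lambda>i. \<theta> i [U']) d"
    "vol a b c (\<lambda>i. \<theta> i [U + U']) = vol a b c (\<lambda>i. \<theta> i [U]) + vol a b c (\<lambda>i. \<theta> i [U'])"
    if "U \<in> vector_fields A" "U' \<in> vector_fields A" for U U' and a b c d :: "nat \<Rightarrow> 'g \<Rightarrow> real"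
    unfolding vol_add[symmetric] using that by (auto intro!: vol_cong comp_add)
  have scale: "vol (\<lambda>i. \<theta> i [u \<odot> U]) b c d = u * vol (\<lambda>i. \<theta> i [U]) b c d"
    "vol a (\<lambda>i. \<theta> i [u \<odot> U]) c d = u * vol a (\<lambda>i. \<theta> i [U]) c d"
    "vol a b (\<lambda>i. \<theta> i [u \<odot> U]) d = u * vol a b (\<lambda>i. \<theta> i [U]) d"
    "vol a b c (\<lambda>i. \<theta> i [u \<odot> U]) = u * vol a b c (\<lambda>i. \<theta> i [U])"
    if "U \<in> vector_fields A" "u \<in> smooth_funs A" for U u and a b c d :: "nat \<Rightarrow> 'g \<Rightarrow> real"
  proof -
    show "vol (\<lambda>i. \<theta> i [u \<odot> U]) b c d = u * vol (\<lambda>i. \<theta> i [U]) b c d"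
      unfolding vol_scale(1)[symmetric] using that by (auto intro!: vol_cong comp_scale)
    show "vol a (\<lambda>i. \<theta> i [u \<odot> U]) c d = u * vol a (\<lambda>i. \<theta> i [U]) c d"
      unfolding vol_scale(2)[symmetric] using that by (auto intro!: vol_cong comp_scale)
    show "vol a b (\<lambda>i. \<theta> i [u \<odot> U]) d = u * vol a b (\<lambda>i. \<theta> i [U]) d"
      unfolding vol_scale(3)[symmetric] using that by (auto intro!: vol_cong comp_scale)
    show "vol a b c (\<lambda>i. \<theta> i [u \<odot> U]) = u * vol a b c (\<lambda>i. \<theta> i [U])"
      unfolding vol_scale(4)[symmetric] using that by (auto intro!: vol_cong comp_scale)
  qed
  show "fundamental_4form Q Xs \<in> smooth_funs A \<and>
     (\<forall>i<4. \<forall>Y\<in>vector_fields A. fundamental_4form Q (Xs[i := Xs ! i + Y]) =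
        fundamental_4form Q Xs + fundamental_4form Q (Xs[i := Y])) \<and>
     (\<forall>i<4. \<forall>u\<in>smooth_funs A. fundamental_4form Q (Xs[i := u \<odot> Xs ! i]) = u * fundamental_4form Q Xs) \<and>
     (\<forall>i<4. \<forall>j<4. i \<noteq> j \<and> Xs ! i = Xs ! j \<longrightarrow> fundamental_4form Q Xs = 0)"
  proof (intro conjI)
    show "fundamental_4form Q Xs \<in> smooth_funs A"
      unfolding Xs_eq by (simp add: fundamental_4form_eq v vol_def smooth_intros)
    show "\<forall>i<4. \<forall>Y\<in>vector_fields A. fundamental_4form Q (Xs[i := Xs ! i + Y]) =
        fundamental_4form Q Xs + fundamental_4form Q (Xs[i := Y])"
      unfolding Xs_eq all4 by (simp add: fundamental_4form_eq v vf_intros add distrib_left)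
    show "\<forall>i<4. \<forall>u\<in>smooth_funs A. fundamental_4form Q (Xs[i := u \<odot> Xs ! i]) = u * fundamental_4form Q Xs"
      unfolding Xs_eq all4 by (simp add: fundamental_4form_eq v vf_intros scale mult.left_commute)
    show "\<forall>i<4. \<forall>j<4. i \<noteq> j \<and> Xs ! i = Xs ! j \<longrightarrow> fundamental_4form Q Xs = 0"
      unfolding Xs_eq all4 using v by (auto simp: fundamental_4form_eq vol_alternating)
  qed
qed

lemma derivation_vol:
  assumes "U \<in> vector_fields A" "W \<in> vector_fields A" "X \<in> vector_fields A" "Y \<in> vector_fields A" "Z \<in> vector_fields A"
  shows "U (vol (\<lambda>i. \<theta> i [W]) (\<lambda>i. \<theta> i [X]) (\<lambda>i. \<theta> i [Y]) (\<lambda>i. \<theta> i [Z])) =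
      vol (\<lambda>i. U (\<theta> i [W])) (\<lambda>i. \<theta> i [X]) (\<lambda>i. \<theta> i [Y]) (\<lambda>i. \<theta> i [Z])
    - vol (\<lambda>i. U (\<theta> i [X])) (\<lambda>i. \<theta> i [W]) (\<lambda>i. \<theta> i [Y]) (\<lambda>i. \<theta> i [Z])
    + vol (\<lambda>i. U (\<theta> i [Y])) (\<lambda>i. \<theta> i [W]) (\<lambda>i. \<theta> i [X]) (\<lambda>i. \<theta> i [Z])
    - vol (\<lambda>i. U (\<theta> i [Z])) (\<lambda>i. \<theta> i [W]) (\<lambda>i. \<theta> i [X]) (\<lambda>i. \<theta> i [Y])"
  using assms by (simp add: vol_def derivation smooth_intros) (simp add: fun_eq_iff algebra_simps)

text \<open>The Leibniz rule \<open>d(\<theta>\<^sub>1 \<and> \<theta>\<^sub>2 \<and> \<theta>\<^sub>3 \<and> \<theta>\<^sub>4) = \<Sum> \<plusminus> d\<theta>\<^sub>a \<and> \<dots>\<close> in terms of values: the derivatives of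
  the components cancel against those in the brackets, and of each bracket only the values \<open>t\<close> of the
  \<open>d\<theta>\<^sub>a\<close> are left.\<close>

lemma ext_d_fundamental_4form:
  assumes v: "V \<in> vector_fields A" "W \<in> vector_fields A" "X \<in> vector_fields A" "Y \<in> vector_fields A" "Z \<in> vector_fields A"
  defines "t \<equiv> \<lambda>X Y i. ext_d (\<theta> i) [X, Y]" and "c \<equiv> \<lambda>X i. \<theta> i [X]"
  shows "ext_d (fundamental_4form Q) [V, W, X, Y, Z] = (\<lambda>_. 6) *
    (vol (t V W) (c X) (c Y) (c Z) - vol (t V X) (c W) (c Y) (c Z) + vol (t V Y) (c W) (c X) (c Z)
   - vol (t V Z) (c W) (c X) (c Y) + vol (t W X) (c V) (c Y) (c Z) - vol (t W Y) (c V) (c X) (c Z)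
   + vol (t W Z) (c V) (c X) (c Y) + vol (t X Y) (c V) (c W) (c Z) - vol (t X Z) (c V) (c W) (c Y)
   + vol (t Y Z) (c V) (c W) (c X))"
proof -
  have smooth: "vol (\<lambda>i. \<theta> i [W]) (\<lambda>i. \<theta> i [X]) (\<lambda>i. \<theta> i [Y]) (\<lambda>i. \<theta> i [Z]) \<in> smooth_funs A"
    if "W \<in> vector_fields A" "X \<in> vector_fields A" "Y \<in> vector_fields A" "Z \<in> vector_fields A" for W X Y Z
    using that by (simp add: vol_def smooth_intros)
  have d: "U (fundamental_4form Q [W, X, Y, Z]) = (\<lambda>_. 6) *
     (vol (\<lambda>i. U (\<theta> i [W])) (c X) (c Y) (c Z) - vol (\<lambda>i. U (\<theta> i [X])) (c W) (c Y) (c Z)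
    + vol (\<lambda>i. U (\<theta> i [Y])) (c W) (c X) (c Z) - vol (\<lambda>i. U (\<theta> i [Z])) (c W) (c X) (c Y))"
    if "U \<in> vector_fields A" "W \<in> vector_fields A" "X \<in> vector_fields A" "Y \<in> vector_fields A" "Z \<in> vector_fields A"
    for U W X Y Z
    using that by (simp add: fundamental_4form_eq derivation smooth smooth_const derivation_vol c_def)
      (simp add: fun_eq_iff algebra_simps)
  have b: "fundamental_4form Q [lie_bracket U W, X, Y, Z] = (\<lambda>_. 6) *
     (vol (\<lambda>i. U (\<theta> i [W])) (c X) (c Y) (c Z) - vol (\<lambda>i. W (\<theta> i [U])) (c X) (c Y) (c Z)
    - vol (t U W) (c X) (c Y) (c Z))"
    if "U \<in> vector_fields A" "W \<in> vector_fields A" "X \<in> vector_fields A" "Y \<in> vector_fields A" "Z \<in> vector_fields A"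
    for U W X Y Z
    using that by (simp add: fundamental_4form_eq vf_intros comp_bracket vol_diff t_def c_def)
  show ?thesis
    unfolding ext_d_4 by (simp only: d b v) (simp add: fun_eq_iff algebra_simps)
qed

end

definition minor3 :: "(nat \<Rightarrow> real) \<Rightarrow> (nat \<Rightarrow> real) \<Rightarrow> (nat \<Rightarrow> real) \<Rightarrow> nat \<Rightarrow> nat \<Rightarrow> nat \<Rightarrow> real" where
  "minor3 h k l a b c = h a * (k b * l c - k c * l b) - h b * (k a * l c - k c * l a) + h c * (k a * l b - k b * l a)"

text \<open>The value of the product of five 1-forms on five vectors, that is, the determinant of five rows
  expanded along the first two of them; it vanishes when a row occurs twice.\<close>

definition wedge5 :: "(nat \<Rightarrow> real) \<Rightarrow> (nat \<Rightarrow> real) \<Rightarrow> (nat \<Rightarrow> real) \<Rightarrow> (nat \<Rightarrow> real) \<Rightarrow> (nat \<Rightarrow> real) \<Rightarrow> real" where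
  "wedge5 f g h k l =
     (f 0 * g 1 - f 1 * g 0) * minor3 h k l 2 3 4 - (f 0 * g 2 - f 2 * g 0) * minor3 h k l 1 3 4
   + (f 0 * g 3 - f 3 * g 0) * minor3 h k l 1 2 4 - (f 0 * g 4 - f 4 * g 0) * minor3 h k l 1 2 3
   + (f 1 * g 2 - f 2 * g 1) * minor3 h k l 0 3 4 - (f 1 * g 3 - f 3 * g 1) * minor3 h k l 0 2 4
   + (f 1 * g 4 - f 4 * g 1) * minor3 h k l 0 2 3 + (f 2 * g 3 - f 3 * g 2) * minor3 h k l 0 1 4
   - (f 2 * g 4 - f 4 * g 2) * minor3 h k l 0 1 3 + (f 3 * g 4 - f 4 * g 3) * minor3 h k l 0 1 2"

lemma wedge5_repeated: "wedge5 f g f k l = 0" "wedge5 f g h f l = 0" "wedge5 f g h k f = 0"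
  unfolding wedge5_def minor3_def by algebra+

lemma vol_minor3:
  "vol t (\<lambda>i. r i j) (\<lambda>i. r i k) (\<lambda>i. r i l) =
     t 1 * minor3 (r 2) (r 3) (r 4) j k l - t 2 * minor3 (r 1) (r 3) (r 4) j k l
   + t 3 * minor3 (r 1) (r 2) (r 4) j k l - t 4 * minor3 (r 1) (r 2) (r 3) j k l"
  by (simp add: vol_def minor3_def algebra_simps)

context g2_coframe
begin

text \<open>Replacing one factor \<open>\<theta>\<^sub>a\<close> of \<open>\<theta>\<^sub>1 \<and> \<theta>\<^sub>2 \<and> \<theta>\<^sub>3 \<and> \<theta>\<^sub>4\<close> by \<open>d\<theta>\<^sub>a\<close> produces only products with a repeated
  factor: every term of \<open>d\<theta>\<^sub>2\<close> and of \<open>d\<theta>\<^sub>3\<close> contains \<open>\<theta>\<^sub>1\<close> or \<open>\<theta>\<^sub>4\<close>, while \<open>d\<theta>\<^sub>4\<close> is a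
  multiple of \<open>\<theta>\<^sub>1 \<and> \<theta>\<^sub>4\<close> and \<open>d\<theta>\<^sub>1 = 0\<close>.\<close>

theorem fundamental_4form_closed: "closed_form A 4 (fundamental_4form Q)"
proof -
  have "ext_d (fundamental_4form Q) Xs = 0" if Xs: "length Xs = Suc 4" "set Xs \<subseteq> vector_fields A" for Xs
  proof -
    obtain V Ys where "Xs = V # Ys" "length Ys = 4" using Xs(1) unfolding length_Suc_conv by blast
    then obtain W X Y Z where Xs_eq: "Xs = [V, W, X, Y, Z]" using length_4[of Ys] by blast
    have v: "V \<in> vector_fields A" "W \<in> vector_fields A" "X \<in> vector_fields A" "Y \<in> vector_fields A"
        "Z \<in> vector_fields A"
      using Xs Xs_eq by auto
    have "ext_d (fundamental_4form Q) Xs p = 0" for p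
    proof -
      define U where "U j = (if j = 0 then V else if j = 1 then W else if j = 2 then X else if j = 3 then Y else Z)"
        for j :: nat
      have U: "U j \<in> vector_fields A" for j using v by (simp add: U_def)
      define r where "r i j = \<theta> i [U j] p" for i j
      define t where "t i j = (\<lambda>a. ext_d (\<theta> a) [U i, U j] p)" for i j
      \<comment> \<open>The coefficients are arbitrary for what follows, and as variables they keep the polynomials free of fractions.\<close>
      obtain \<alpha> \<beta> \<gamma> :: real where coeffs: "\<alpha> = 2/3" "\<beta> = 1/6" "\<gamma> = 1/3" by blast
      have "ext_d (fundamental_4form Q) Xs p = 6 *
        (vol (t 0 1) (\<lambda>i. r i 2) (\<lambda>i. r i 3) (\<lambda>i. r i 4) - vol (t 0 2) (\<lambda>i. r i 1) (\<lambda>i. r i 3) (\<lambda>i. r i 4)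
       + vol (t 0 3) (\<lambda>i. r i 1) (\<lambda>i. r i 2) (\<lambda>i. r i 4) - vol (t 0 4) (\<lambda>i. r i 1) (\<lambda>i. r i 2) (\<lambda>i. r i 3)
       + vol (t 1 2) (\<lambda>i. r i 0) (\<lambda>i. r i 3) (\<lambda>i. r i 4) - vol (t 1 3) (\<lambda>i. r i 0) (\<lambda>i. r i 2) (\<lambda>i. r i 4)
       + vol (t 1 4) (\<lambda>i. r i 0) (\<lambda>i. r i 2) (\<lambda>i. r i 3) + vol (t 2 3) (\<lambda>i. r i 0) (\<lambda>i. r i 1) (\<lambda>i. r i 4)
       - vol (t 2 4) (\<lambda>i. r i 0) (\<lambda>i. r i 1) (\<lambda>i. r i 3) + vol (t 3 4) (\<lambda>i. r i 0) (\<lambda>i. r i 1) (\<lambda>i. r i 2))"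
        by (subst Xs_eq, subst ext_d_fundamental_4form[OF v])
           (simp add: vol_apply r_def t_def U_def)
      also have "\<dots> = 6 * (
        - (\<alpha> * wedge5 (r 1) (r 2) (r 1) (r 3) (r 4) + \<beta> * wedge5 (r 1) (r 5) (r 1) (r 3) (r 4)
           - \<gamma> * wedge5 (r 3) (r 4) (r 1) (r 3) (r 4) + \<beta> * wedge5 (r 4) (r 6) (r 1) (r 3) (r 4))
        + (- \<alpha> * wedge5 (r 1) (r 3) (r 1) (r 2) (r 4) + \<beta> * wedge5 (r 1) (r 6) (r 1) (r 2) (r 4)
           - wedge5 (r 2) (r 4) (r 1) (r 2) (r 4) - \<beta> * wedge5 (r 4) (r 5) (r 1) (r 2) (r 4))
        + \<alpha> * wedge5 (r 1) (r 4) (r 1) (r 2) (r 3))"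
      proof -
        have T: "t i j 1 = 0" "t i j 4 = - \<alpha> * (r 1 i * r 4 j - r 1 j * r 4 i)"
          "t i j 2 = \<alpha> * (r 1 i * r 2 j - r 1 j * r 2 i) + \<beta> * (r 1 i * r 5 j - r 1 j * r 5 i)
             - \<gamma> * (r 3 i * r 4 j - r 3 j * r 4 i) + \<beta> * (r 4 i * r 6 j - r 4 j * r 6 i)"
          "t i j 3 = - \<alpha> * (r 1 i * r 3 j - r 1 j * r 3 i) + \<beta> * (r 1 i * r 6 j - r 1 j * r 6 i)
             - (r 2 i * r 4 j - r 2 j * r 4 i) - \<beta> * (r 4 i * r 5 j - r 4 j * r 5 i)"
          for i j
        proof -
          show "t i j 1 = 0" "t i j 4 = - \<alpha> * (r 1 i * r 4 j - r 1 j * r 4 i)"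
          "t i j 2 = \<alpha> * (r 1 i * r 2 j - r 1 j * r 2 i) + \<beta> * (r 1 i * r 5 j - r 1 j * r 5 i)
             - \<gamma> * (r 3 i * r 4 j - r 3 j * r 4 i) + \<beta> * (r 4 i * r 6 j - r 4 j * r 6 i)"
          "t i j 3 = - \<alpha> * (r 1 i * r 3 j - r 1 j * r 3 i) + \<beta> * (r 1 i * r 6 j - r 1 j * r 6 i)
             - (r 2 i * r 4 j - r 2 j * r 4 i) - \<beta> * (r 4 i * r 5 j - r 4 j * r 5 i)"
            by (simp_all add: t_def r_def structure_equations U coeffs)
        qed
        show ?thesis
          by (simp add: vol_minor3 wedge5_def T algebra_simps)
      qed
      also have "\<dots> = 0" by (simp add: wedge5_repeated)
      finally show ?thesis .
    qed
    then show ?thesis by (simp add: fun_eq_iff)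
  qed
  then show ?thesis
    unfolding closed_form_def form_eq_def using fundamental_4form_diff_form by simp
qed

end

section \<open>The seven-dimensional solvable group\<close>

theorem theorem4p5:
  fixes A :: "('g::{t2_space, second_countable_topology}, real ^ 7) atlas"
    and G :: "'g monoid"
    and \<theta> :: "nat \<Rightarrow> 'g form"
    and e :: "nat \<Rightarrow> 'g vfield"
    and Q :: "'g qc"
  assumes "lie_group A G"
    and "simply_connected (UNIV :: 'g set)"
    and "solvable G"
    and "left_inv_dual_bases A G 7 \<theta> e"
    and "form_eq A 2 (ext_d (\<theta> 1)) 0"
    and "form_eq A 2 (ext_d (\<theta> 2))
      ((2/3) \<cdot>\<^sub>R cowedge \<theta> 1 2 + (1/6) \<cdot>\<^sub>R cowedge \<theta> 1 5
        - (1/3) \<cdot>\<^sub>R cowedge \<theta> 3 4 + (1/6) \<cdot>\<^sub>R cowedge \<theta> 4 6)"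
    and "form_eq A 2 (ext_d (\<theta> 3))
      (- ((2/3) \<cdot>\<^sub>R cowedge \<theta> 1 3) + (1/6) \<cdot>\<^sub>R cowedge \<theta> 1 6
        - cowedge \<theta> 2 4 - (1/6) \<cdot>\<^sub>R cowedge \<theta> 4 5)"
    and "form_eq A 2 (ext_d (\<theta> 4)) (- ((2/3) \<cdot>\<^sub>R cowedge \<theta> 1 4))"
    and "form_eq A 2 (ext_d (\<theta> 5))
      (2 \<cdot>\<^sub>R (cowedge \<theta> 1 2 + cowedge \<theta> 3 4) - cowedge \<theta> 4 6)"
    and "form_eq A 2 (ext_d (\<theta> 6))
      (2 \<cdot>\<^sub>R (cowedge \<theta> 1 3 + cowedge \<theta> 4 2) + cowedge \<theta> 4 5)"
    and "form_eq A 2 (ext_d (\<theta> 7))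
      (2 \<cdot>\<^sub>R (cowedge \<theta> 1 4 + cowedge \<theta> 2 3) - (1/6) \<cdot>\<^sub>R cowedge \<theta> 5 6)"
    and "Q = coframe_qc A \<theta> e"
  shows "integrable_qc A Q \<and> (\<exists>D. biquard_connection A Q D) \<and>
    (\<forall>D. biquard_connection A Q D \<longrightarrow>
       nonzero_torsion_endo A Q D \<and>
       (\<forall>E. hor_orthonormal_frame Q E \<longrightarrow> norm_qc_scal Q D E = (\<lambda>p. - 1/6))) \<and>
    closed_form A 4 (fundamental_4form Q)"
proof -
  interpret coframe A 7 \<theta> e
    by (rule left_inv_dual_bases_coframe[where 'n = 7, OF assms(1,4)]) simp
  interpret coframe7 A \<theta> e Q
    by unfold_locales (rule assms(12))
  have form_eq: "\<alpha> [X, Y] = \<beta> [X, Y]"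
    if "form_eq A 2 \<alpha> \<beta>" "X \<in> vector_fields A" "Y \<in> vector_fields A" for \<alpha> \<beta> X Y
    using that unfolding form_eq_def by (drule_tac spec[of _ "[X, Y]"]) simp
  interpret g2_coframe A \<theta> e Q
    by unfold_locales
       (simp_all add: form_eq[OF assms(5)] form_eq[OF assms(6)] form_eq[OF assms(7)] form_eq[OF assms(8)]
          form_eq[OF assms(9)] form_eq[OF assms(10)] form_eq[OF assms(11)] rscale_def cowedge_eq field_simps)
  show ?thesis
    using integrable_qc bconn_biquard biquard_nonzero_torsion biquard_norm_qc_scal fundamental_4form_closed
    by blast
qed

end
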